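(* Let $\mathbb{F}$ be a field of characteristic different from $2$ and let $A$ be a unital locally matrix algebra over $\mathbb{F}$. Then: (1) the Lie algebra $[\operatorname{Der}(A),\operatorname{Der}(A)]$ is topologically simple; (2) the Lie algebra $\operatorname{Der}(A)$ is topologically simple if and only if either $\operatorname{char}\mathbb{F}=0$, or $\operatorname{char}\mathbb{F}=p>0$ and $\nu_p(\mathbf{st}(A))=0$ or $\infty$.
   Context: An associative $\mathbb{F}$-algebra $A$ is called a locally matrix algebra if for every finite subset of $A$ there is a subalgebra $B\subset A$ containing this subset with $B\cong M_n(\mathbb{F})$ for some $n\in\mathbb{N}$ (positive integers). It is unital if it contains a unit $1$. Let $\mathbb{P}$ be the set of all primes. A Steinitz number is an infinite formal product $s=\prod_{p\in\mathbb{P}}p^{r_p}$ with $r_p\in\mathbb{N}\cup\{0,\infty\}$ for all $p\in\mathbb{P}$; put $\nu_p(s)=r_p$. Steinitz numbers are multiplied by adding exponents (with $t+\infty=\infty+t=\infty+\infty=\infty$), and divisibility and least common multiples are understood accordingly (exponentwise; the least common multiple is given by the exponentwise supremum). For a unital locally matrix algebra $A$, let $D(A)$ be the set of all $n\in\mathbb{N}$ such that there is a subalgebra $A'\subseteq A$ with $1\in A'$ and $A'\cong M_n(\mathbb{F})$. The Steinitz number $\mathbf{st}(A)$ of $A$ is the least common multiple of the set $D(A)$. A derivation of $A$ is a linear map $d:A\to A$ with $d(ab)=d(a)b+a\,d(b)$ for all $a,b\in A$. $\operatorname{Der}(A)$ is the Lie algebra of all derivations of $A$ under the commutator bracket, and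 for a Lie algebra $L$, $[L,L]$ denotes the linear span of all brackets. The set $\operatorname{Map}(A,A)$ of all maps $A\to A$ carries the Tykhonoff topology, i.e. the product topology on $A^A$ with $A$ discrete (the topology of pointwise convergence: basic neighbourhoods of $f$ consist of the maps agreeing with $f$ on a given finite subset of $A$). $\operatorname{Der}(A)$ is closed in $\operatorname{Map}(A,A)$ and is a topological Lie algebra with the subspace topology; $[\operatorname{Der}(A),\operatorname{Der}(A)]$ is given the subspace topology as well. A topological Lie algebra $L$ is called topologically simple here if it has no closed ideals (closed in $L$) other than $\{0\}$ and $L$. *)

theory Defs
  imports
    "HOL-Analysis.Function_Topology"
    "HOL-Computational_Algebra.Primes"
    "HOL-Library.Extended_Nat"
    "HOL-Library.Function_Algebras"
    "Jordan_Normal_Form.Matrix"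
begin

section \<open>Associative algebras\<close>

text \<open>
  The underlying additive group and multiplication of an \<open>\<bbbF>\<close>-algebra are those of the type class;
  a unit is present exactly when the type is of class \<open>ring_1\<close>. That class admits the zero ring,
  which the definition of a locally matrix algebra below rules out.
\<close>

locale assoc_algebra = vector_space smul
  for smul :: "'f::field \<Rightarrow> 'a::ring \<Rightarrow> 'a" +
  assumes smul_mult_left: "smul c x * y = smul c (x * y)"
    and smul_mult_right: "x * smul c y = smul c (x * y)"

definition subalgebra :: "('f::field \<Rightarrow> 'a::ring \<Rightarrow> 'a) \<Rightarrow> 'a set \<Rightarrow> bool" where
  "subalgebra smul B \<longleftrightarrow> module.subspace smul B \<and> (\<forall>x\<in>B. \<forall>y\<in>B. x * y \<in> B)"

definition iso_matrix_algebra :: "('f::field \<Rightarrow> 'a::ring \<Rightarrow> 'a) \<Rightarrow> 'a set \<Rightarrow> nat \<Rightarrow> bool" where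
  "iso_matrix_algebra smul B n \<longleftrightarrow>
     (\<exists>\<phi> :: 'a \<Rightarrow> 'f mat. bij_betw \<phi> B (carrier_mat n n) \<and>
        (\<forall>x\<in>B. \<forall>y\<in>B. \<phi> (x + y) = \<phi> x + \<phi> y) \<and>
        (\<forall>c. \<forall>x\<in>B. \<phi> (smul c x) = c \<cdot>\<^sub>m \<phi> x) \<and>
        (\<forall>x\<in>B. \<forall>y\<in>B. \<phi> (x * y) = \<phi> x * \<phi> y))"

locale locally_matrix_algebra = assoc_algebra smul
  for smul :: "'f::field \<Rightarrow> 'a::ring \<Rightarrow> 'a" +
  assumes locally_matrix:
    "finite S \<Longrightarrow> \<exists>B n. S \<subseteq> B \<and> subalgebra smul B \<and> 0 < n \<and> iso_matrix_algebra smul B n"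


section \<open>Steinitz numbers\<close>

text \<open>A Steinitz number is given by its exponents, a function on the primes (extended by 0).\<close>

typedef steinitz = "{r :: nat \<Rightarrow> enat. \<forall>p. \<not> prime p \<longrightarrow> r p = 0}"
  morphisms nu Abs_steinitz
  by (rule exI[of _ "\<lambda>_. 0"]) simp

setup_lifting type_definition_steinitz

lemma steinitz_eqI: "(\<And>p. prime p \<Longrightarrow> nu s p = nu t p) \<Longrightarrow> s = t"
  by transfer (metis ext)

instantiation steinitz :: comm_monoid_mult
begin

lift_definition one_steinitz :: steinitz is "\<lambda>_. 0" by simp

lift_definition times_steinitz :: "steinitz \<Rightarrow> steinitz \<Rightarrow> steinitz" is "\<lambda>r s p. r p + s p"
  by simp

instance
  by standard (transfer; simp add: ac_simps fun_eq_iff)+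

end

text \<open>Natural numbers are embedded by their prime factorisation; only positive ones are relevant.\<close>

lift_definition steinitz_of_nat :: "nat \<Rightarrow> steinitz" is
  "\<lambda>n p. if prime p then enat (multiplicity p n) else 0"
  by simp

lift_definition steinitz_lcm :: "steinitz set \<Rightarrow> steinitz" is
  "\<lambda>S p. if prime p then SUP r\<in>S. r p else 0"
  by simp

lemma steinitz_dvd_iff: "s dvd t \<longleftrightarrow> (\<forall>p. nu s p \<le> nu t p)"
proof
  assume "s dvd t"
  then obtain u where "t = s * u" by (rule dvdE)
  then show "\<forall>p. nu s p \<le> nu t p" by (simp add: times_steinitz.rep_eq)
next
  assume le: "\<forall>p. nu s p \<le> nu t p"
  define e where "e p = (if prime p then SOME c. nu t p = nu s p + c else 0)" for p
  have e: "nu t p = nu s p + e p" if "prime p" for p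
    using someI_ex[of "\<lambda>c. nu t p = nu s p + c"] le that
    by (simp add: e_def le_iff_add)
  have "nu (Abs_steinitz e) = e" by (rule Abs_steinitz_inverse) (simp add: e_def)
  then have "t = s * Abs_steinitz e"
    by (intro steinitz_eqI) (simp add: times_steinitz.rep_eq e)
  then show "s dvd t" by (rule dvdI)
qed

lemma nu_steinitz_lcm: "nu (steinitz_lcm S) p = (if prime p then SUP s\<in>S. nu s p else 0)"
  by (simp add: steinitz_lcm.rep_eq image_image)

lemma dvd_steinitz_lcm: "s \<in> S \<Longrightarrow> s dvd steinitz_lcm S"
  using nu[of s] by (auto simp: steinitz_dvd_iff nu_steinitz_lcm intro: SUP_upper)

lemma steinitz_lcm_least: "(\<And>s. s \<in> S \<Longrightarrow> s dvd t) \<Longrightarrow> steinitz_lcm S dvd t"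
  by (auto simp: steinitz_dvd_iff nu_steinitz_lcm intro: SUP_least)

definition unital_matrix_degrees :: "('f::field \<Rightarrow> 'a::ring_1 \<Rightarrow> 'a) \<Rightarrow> nat set" where
  "unital_matrix_degrees smul =
     {n. 0 < n \<and> (\<exists>B. subalgebra smul B \<and> 1 \<in> B \<and> iso_matrix_algebra smul B n)}"

definition steinitz_number :: "('f::field \<Rightarrow> 'a::ring_1 \<Rightarrow> 'a) \<Rightarrow> steinitz" where
  "steinitz_number smul = steinitz_lcm (steinitz_of_nat ` unital_matrix_degrees smul)"


section \<open>Lie algebras of linear maps\<close>

definition fun_smul :: "('f \<Rightarrow> 'a \<Rightarrow> 'a) \<Rightarrow> 'f \<Rightarrow> ('a \<Rightarrow> 'a) \<Rightarrow> 'a \<Rightarrow> 'a" where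
  "fun_smul smul c f = (\<lambda>x. smul c (f x))"

lemma vector_space_fun_smul:
  fixes smul :: "'f::field \<Rightarrow> 'a::ab_group_add \<Rightarrow> 'a"
  assumes "vector_space smul"
  shows "vector_space (fun_smul smul)"
proof -
  interpret vector_space smul by fact
  show ?thesis
    by standard (simp_all add: fun_smul_def fun_eq_iff scale_right_distrib scale_left_distrib)
qed

definition commutator :: "('a::ab_group_add \<Rightarrow> 'a) \<Rightarrow> ('a \<Rightarrow> 'a) \<Rightarrow> 'a \<Rightarrow> 'a" where
  "commutator f g = (\<lambda>x. f (g x) - g (f x))"

definition derivation :: "('f::field \<Rightarrow> 'a::ring \<Rightarrow> 'a) \<Rightarrow> ('a \<Rightarrow> 'a) \<Rightarrow> bool" where
  "derivation smul d \<longleftrightarrow>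
     Vector_Spaces.linear smul smul d \<and> (\<forall>a b. d (a * b) = d a * b + a * d b)"

definition Der :: "('f::field \<Rightarrow> 'a::ring \<Rightarrow> 'a) \<Rightarrow> ('a \<Rightarrow> 'a) set" where
  "Der smul = {d. derivation smul d}"

definition lie_derived ::
    "('f::field \<Rightarrow> 'a::ab_group_add \<Rightarrow> 'a) \<Rightarrow> ('a \<Rightarrow> 'a) set \<Rightarrow> ('a \<Rightarrow> 'a) set" where
  "lie_derived smul L = module.span (fun_smul smul) {commutator d e |d e. d \<in> L \<and> e \<in> L}"

definition lie_subalgebra ::
    "('f::field \<Rightarrow> 'a::ab_group_add \<Rightarrow> 'a) \<Rightarrow> ('a \<Rightarrow> 'a) set \<Rightarrow> bool" where
  "lie_subalgebra smul L \<longleftrightarrow>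
     module.subspace (fun_smul smul) L \<and> (\<forall>d\<in>L. \<forall>e\<in>L. commutator d e \<in> L)"

text \<open>Two-sidedness of ideals is automatic by antisymmetry of the commutator.\<close>

definition lie_ideal ::
    "('f::field \<Rightarrow> 'a::ab_group_add \<Rightarrow> 'a) \<Rightarrow> ('a \<Rightarrow> 'a) set \<Rightarrow> ('a \<Rightarrow> 'a) set \<Rightarrow> bool" where
  "lie_ideal smul L I \<longleftrightarrow>
     module.subspace (fun_smul smul) I \<and> I \<subseteq> L \<and> (\<forall>d\<in>L. \<forall>e\<in>I. commutator d e \<in> I)"

definition tykhonoff :: "('a \<Rightarrow> 'a) topology" where
  "tykhonoff = product_topology (\<lambda>_. discrete_topology UNIV) UNIV"

text \<open>By convention \<open>L\<close> is allowed to be zero or abelian.\<close>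

definition topologically_simple ::
    "('f::field \<Rightarrow> 'a::ab_group_add \<Rightarrow> 'a) \<Rightarrow> ('a \<Rightarrow> 'a) set \<Rightarrow> bool" where
  "topologically_simple smul L \<longleftrightarrow>
     (\<forall>I. lie_ideal smul L I \<and> closedin (subtopology tykhonoff L) I \<longrightarrow> I = {0} \<or> I = L)"

lemma (in assoc_algebra) lie_subalgebra_Der: "lie_subalgebra smul (Der smul)"
proof -
  interpret F: vector_space "fun_smul smul"
    by (rule vector_space_fun_smul) (rule vector_space_axioms)
  have mem: "d \<in> Der smul \<longleftrightarrow> (\<forall>x y. d (x + y) = d x + d y) \<and>
      (\<forall>c x. d (smul c x) = smul c (d x)) \<and> (\<forall>x y. d (x * y) = d x * y + x * d y)" for d
    unfolding Der_def derivation_def Vector_Spaces.linear_def module_hom_def module_hom_axioms_def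
    using vector_space_axioms module_axioms by auto
  show ?thesis
    unfolding lie_subalgebra_def F.subspace_def
    by (auto simp: mem commutator_def fun_smul_def scale_right_distrib scale_right_diff_distrib
        smul_mult_left smul_mult_right scale_left_commute distrib_left distrib_right
        left_diff_distrib right_diff_distrib mult.assoc)
qed

lemma lie_subalgebra_lie_derived:
  assumes "vector_space smul" and "lie_subalgebra smul L"
  shows "lie_subalgebra smul (lie_derived smul L)" and "lie_derived smul L \<subseteq> L"
proof -
  interpret F: vector_space "fun_smul smul"
    by (rule vector_space_fun_smul) (rule assms(1))
  show sub: "lie_derived smul L \<subseteq> L"
    unfolding lie_derived_def
    using assms(2) by (intro F.span_minimal) (auto simp: lie_subalgebra_def)
  show "lie_subalgebra smul (lie_derived smul L)"
    unfolding lie_subalgebra_def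
    using sub by (auto simp: lie_derived_def intro!: F.span_base)
qed

end

theory Submission
  imports Defs
begin

text \<open>
  Inner derivations are written \<open>ad a\<close>, so \<open>ad a b\<close> is also the commutator of \<open>a\<close> and \<open>b\<close>.
  Everything is governed by the space \<open>inner_commutators\<close> of the maps \<open>ad x\<close>, where \<open>x\<close> runs
  through the span of all commutators of \<open>A\<close>.

  Two observations give the simplicity statements. On a unital matrix subalgebra every derivation
  is inner (\<open>derivation_inner_on_full\<close>), so inner derivations approximate every derivation, and
  brackets of derivations are limits of maps \<open>ad (ad a b)\<close>
  (\<open>lie_derived_Der_subset_closure\<close>). If a Lie algebra \<open>L\<close> of derivations contains
  \<open>inner_commutators\<close>, then so does every nonzero ideal \<open>I\<close> of \<open>L\<close>
  (\<open>nonzero_ideal_contains_inner_commutators\<close>): bracketing a nonzero \<open>d \<in> I\<close> with an off-diagonal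
  matrix unit produces some \<open>ad y \<in> I\<close> with \<open>y\<close> not scalar, and in characteristic other than 2 a
  nonscalar matrix generates all commutators of its matrix algebra under bracketing with
  commutators (\<open>lie_ideal_contains_commutators\<close>). Hence \<open>L\<close> is topologically simple as soon as it
  lies in the pointwise closure of \<open>inner_commutators\<close>. The derived algebra always does.

  For the algebra of all derivations the question is whether a rank one idempotent \<open>e\<^sub>0\<^sub>0\<close> of a
  unital matrix subalgebra \<open>M\<^sub>n\<close> lies, up to a scalar, in the span of the commutators, because
  every matrix is a multiple of \<open>e\<^sub>0\<^sub>0\<close> modulo commutators. If \<open>n\<close> is invertible in the field,
  as it always is in characteristic 0 and when the exponent of the characteristic in the Steinitz
  number is 0, then \<open>e\<^sub>0\<^sub>0 - 1/n\<close> is a sum of commutators. In general, if \<open>M\<^sub>n\<close> sits unitally in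
  a matrix algebra \<open>M\<^sub>N\<close> with matrix units \<open>f\<^sub>i\<^sub>j\<close>, then \<open>N = n r\<close> and \<open>e\<^sub>0\<^sub>0\<close> has rank \<open>r\<close> in \<open>M\<^sub>N\<close>, so it is
  congruent to \<open>r f\<^sub>0\<^sub>0\<close> modulo commutators (\<open>embedded_matrix_units\<close>). If the exponent of the
  characteristic \<open>p\<close> in the Steinitz number is infinite, then \<open>N\<close> can be chosen with \<open>p\<close> dividing
  \<open>r\<close>, and \<open>e\<^sub>0\<^sub>0\<close> is a sum of commutators. If that exponent is positive and finite, take \<open>n\<close> with
  the largest possible power of \<open>p\<close>; then \<open>r\<close> is always prime to \<open>p\<close>, so \<open>e\<^sub>0\<^sub>0\<close> has nonzero trace
  in \<open>M\<^sub>N\<close>, whereas elements commuting with \<open>M\<^sub>n\<close> have trace divisible by \<open>n\<close>, that is, zero.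
  Therefore \<open>ad e\<^sub>0\<^sub>0\<close> is not a limit of maps in \<open>inner_commutators\<close>, and the closure of
  \<open>inner_commutators\<close> is a proper nonzero closed ideal (\<open>not_topologically_simple_Der\<close>).
\<close>

section \<open>Pointwise limits and closed ideals\<close>

definition pointwise_closure :: "('a \<Rightarrow> 'a) set \<Rightarrow> ('a \<Rightarrow> 'a) set" where
  "pointwise_closure I = {f. \<forall>S. finite S \<longrightarrow> (\<exists>g\<in>I. \<forall>s\<in>S. f s = g s)}"

lemma closure_of_tykhonoff: "tykhonoff closure_of I = pointwise_closure I"
proof (intro equalityI subsetI)
  fix f assume f: "f \<in> tykhonoff closure_of I"
  show "f \<in> pointwise_closure I"
    unfolding pointwise_closure_def
  proof (intro CollectI allI impI)
    fix S :: "'a set" assume S: "finite S"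
    let ?U = "\<Pi>\<^sub>E x\<in>UNIV. if x \<in> S then {f x} else UNIV"
    have "openin tykhonoff ?U"
      unfolding tykhonoff_def by (rule product_topology_basis) (auto intro: finite_subset[OF _ S])
    moreover have "f \<in> ?U" by (auto simp: PiE_def)
    ultimately obtain g where "g \<in> I" "g \<in> ?U"
      using f unfolding in_closure_of by blast
    moreover have "f s = g s" if "s \<in> S" for s
      using PiE_mem[OF \<open>g \<in> ?U\<close>, of s] that by simp
    ultimately show "\<exists>g\<in>I. \<forall>s\<in>S. f s = g s" by blast
  qed
next
  fix f assume f: "f \<in> pointwise_closure I"
  show "f \<in> tykhonoff closure_of I"
    unfolding in_closure_of
  proof (intro conjI allI impI)
    show "f \<in> topspace tykhonoff" by (simp add: tykhonoff_def)
  next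
    fix U assume "f \<in> U \<and> openin tykhonoff U"
    then have "openin (product_topology (\<lambda>_. discrete_topology UNIV) UNIV) U" "f \<in> U"
      by (simp_all add: tykhonoff_def)
    from product_topology_open_contains_basis[OF this]
    obtain X where X: "f \<in> (\<Pi>\<^sub>E i\<in>UNIV. X i)" "finite {i. X i \<noteq> UNIV}"
        "(\<Pi>\<^sub>E i\<in>UNIV. X i) \<subseteq> U"
      by (auto simp only: topspace_discrete_topology)
    from f X(2) obtain g where g: "g \<in> I" "\<forall>s\<in>{i. X i \<noteq> UNIV}. f s = g s"
      unfolding pointwise_closure_def by blast
    have "g i \<in> X i" for i
      using g(2) PiE_mem[OF X(1), of i] by (cases "X i = UNIV") auto
    then have "g \<in> U" using X(3) by (auto simp: PiE_def)
    with g(1) show "\<exists>y. y \<in> I \<and> y \<in> U" by blast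
  qed
qed

text \<open>
  Thus a closed ideal is tested on finite sets of arguments, which is the only form in which the
  topology enters below.
\<close>

lemma closedin_tykhonoff_iff:
  "closedin (subtopology tykhonoff L) I \<longleftrightarrow> I \<subseteq> L \<and> L \<inter> pointwise_closure I \<subseteq> I"
proof -
  have sub: "I \<subseteq> pointwise_closure I" by (auto simp: pointwise_closure_def)
  show ?thesis
  proof (cases "I \<subseteq> L")
    case True
    then have "L \<inter> I = I" by blast
    then show ?thesis
      unfolding closure_of_eq[symmetric] closure_of_subtopology closure_of_tykhonoff
      using sub True by auto
  next
    case False
    then show ?thesis using closedin_subset[of "subtopology tykhonoff L" I] by auto
  qed
qed

lemma pointwise_closure_superset: "I \<subseteq> pointwise_closure I"
  by (auto simp: pointwise_closure_def)

lemma pointwise_closure_mono: "I \<subseteq> J \<Longrightarrow> pointwise_closure I \<subseteq> pointwise_closure J"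
  unfolding pointwise_closure_def by blast

lemma pointwise_closure_idem: "pointwise_closure (pointwise_closure I) = pointwise_closure I"
  unfolding closure_of_tykhonoff[symmetric] by (rule closure_of_closure_of)

lemma pointwise_closureD:
  "f \<in> pointwise_closure I \<Longrightarrow> finite S \<Longrightarrow> \<exists>g\<in>I. \<forall>s\<in>S. f s = g s"
  by (simp add: pointwise_closure_def)


section \<open>Inner derivations\<close>

definition ad :: "'a::ring \<Rightarrow> 'a \<Rightarrow> 'a" where
  "ad a x = a * x - x * a"

lemma commutator_swap: "commutator f g = - commutator g f"
  by (auto simp: commutator_def)

lemma ad_zero: "ad 0 = 0"
  by (auto simp: ad_def)

lemma ad_add: "ad (x + y) = ad x + ad y"
  by (auto simp: ad_def algebra_simps)

context assoc_algebra
begin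

sublocale F: vector_space "fun_smul smul"
  by (rule vector_space_fun_smul) (rule vector_space_axioms)

lemma mem_Der_iff:
  "d \<in> Der smul \<longleftrightarrow> (\<forall>x y. d (x + y) = d x + d y) \<and>
    (\<forall>c x. d (smul c x) = smul c (d x)) \<and> (\<forall>x y. d (x * y) = d x * y + x * d y)"
  unfolding Der_def derivation_def Vector_Spaces.linear_def module_hom_def module_hom_axioms_def
  using vector_space_axioms module_axioms by auto

lemma Der_add: "d \<in> Der smul \<Longrightarrow> d (x + y) = d x + d y"
  and Der_smul: "d \<in> Der smul \<Longrightarrow> d (smul c x) = smul c (d x)"
  and Der_mult: "d \<in> Der smul \<Longrightarrow> d (x * y) = d x * y + x * d y"
  by (auto simp: mem_Der_iff)

lemma Der_zero: "d \<in> Der smul \<Longrightarrow> d 0 = 0"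
  using Der_smul[of d 0 0] by simp

lemma Der_diff: "d \<in> Der smul \<Longrightarrow> d (x - y) = d x - d y"
  using Der_add[of d "x - y" y] by simp

lemma Der_ad: "d \<in> Der smul \<Longrightarrow> d (ad a b) = ad (d a) b + ad a (d b)"
  by (simp add: ad_def Der_diff Der_mult)

lemma ad_in_Der: "ad a \<in> Der smul"
  by (auto simp: mem_Der_iff ad_def algebra_simps smul_mult_left smul_mult_right scale_right_diff_distrib)

lemma commutator_ad: "d \<in> Der smul \<Longrightarrow> commutator d (ad x) = ad (d x)"
  by (auto simp: commutator_def ad_def Der_diff Der_mult)

lemma ad_smul: "ad (smul c x) = fun_smul smul c (ad x)"
  by (auto simp: ad_def fun_smul_def smul_mult_left smul_mult_right scale_right_diff_distrib)

lemma subspace_ad_vimage: "F.subspace I \<Longrightarrow> subspace {x. ad x \<in> I}"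
  unfolding subspace_def F.subspace_def by (auto simp: ad_add ad_smul ad_zero)

definition commutator_span :: "'a set \<Rightarrow> 'a set" where
  "commutator_span C = span {ad a b |a b. a \<in> C \<and> b \<in> C}"

lemma subspace_commutator_span: "subspace (commutator_span C)"
  by (simp add: commutator_span_def)

lemma ad_in_commutator_span: "a \<in> C \<Longrightarrow> b \<in> C \<Longrightarrow> ad a b \<in> commutator_span C"
  unfolding commutator_span_def by (intro span_base) blast

lemma commutator_span_mono: "C \<subseteq> D \<Longrightarrow> commutator_span C \<subseteq> commutator_span D"
  unfolding commutator_span_def by (intro span_mono) blast

lemma commutator_span_minimal:
  "subspace J \<Longrightarrow> (\<And>a b. a \<in> C \<Longrightarrow> b \<in> C \<Longrightarrow> ad a b \<in> J) \<Longrightarrow> commutator_span C \<subseteq> J"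
  unfolding commutator_span_def by (rule span_minimal) auto

lemma ad_in_lie_derived:
  assumes "x \<in> commutator_span UNIV"
  shows "ad x \<in> lie_derived smul (Der smul)"
proof -
  have "commutator_span UNIV \<subseteq> {x. ad x \<in> lie_derived smul (Der smul)}"
  proof (rule commutator_span_minimal)
    show "subspace {x. ad x \<in> lie_derived smul (Der smul)}"
      by (rule subspace_ad_vimage) (simp add: lie_derived_def)
    show "ad a b \<in> {x. ad x \<in> lie_derived smul (Der smul)}" for a b
      unfolding lie_derived_def mem_Collect_eq commutator_ad[OF ad_in_Der, symmetric]
      by (intro F.span_base) (use ad_in_Der in blast)
  qed
  with assms show ?thesis by blast
qed

text \<open>
  This is why the closure of the inner derivations by commutators is an ideal among all
  derivations, since bracketing \<open>ad x\<close> with \<open>d\<close> gives \<open>ad (d x)\<close>.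
\<close>

lemma derivation_image_commutator_span:
  assumes "d \<in> Der smul" "x \<in> commutator_span UNIV"
  shows "d x \<in> commutator_span UNIV"
proof -
  have "commutator_span UNIV \<subseteq> {x. d x \<in> commutator_span UNIV}"
    using assms(1) subspace_commutator_span[of UNIV]
    by (intro commutator_span_minimal)
      (auto simp: subspace_def Der_zero Der_add Der_smul Der_ad intro: ad_in_commutator_span)
  with assms(2) show ?thesis by blast
qed

lemma subspace_pointwise_closure:
  assumes "F.subspace I" shows "F.subspace (pointwise_closure I)"
  unfolding F.subspace_def
proof (intro conjI ballI allI)
  show "0 \<in> pointwise_closure I"
    using F.subspace_0[OF assms] pointwise_closure_superset by blast
next
  fix f g assume f: "f \<in> pointwise_closure I" and g: "g \<in> pointwise_closure I"
  show "f + g \<in> pointwise_closure I"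
    unfolding pointwise_closure_def
  proof (intro CollectI allI impI)
    fix S :: "'a set" assume "finite S"
    then obtain f' g' where "f' \<in> I" "\<forall>s\<in>S. f s = f' s" "g' \<in> I" "\<forall>s\<in>S. g s = g' s"
      using pointwise_closureD[OF f] pointwise_closureD[OF g] by meson
    then show "\<exists>h\<in>I. \<forall>s\<in>S. (f + g) s = h s"
      using F.subspace_add[OF assms] by (intro bexI[of _ "f' + g'"]) auto
  qed
next
  fix c f assume f: "f \<in> pointwise_closure I"
  show "fun_smul smul c f \<in> pointwise_closure I"
    unfolding pointwise_closure_def
  proof (intro CollectI allI impI)
    fix S :: "'a set" assume "finite S"
    then obtain f' where "f' \<in> I" "\<forall>s\<in>S. f s = f' s"
      using pointwise_closureD[OF f] by meson
    then show "\<exists>h\<in>I. \<forall>s\<in>S. fun_smul smul c f s = h s"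
      using F.subspace_scale[OF assms]
      by (intro bexI[of _ "fun_smul smul c f'"]) (auto simp: fun_smul_def)
  qed
qed

definition inner_commutators :: "('a \<Rightarrow> 'a) set" where
  "inner_commutators = ad ` commutator_span UNIV"

lemma subspace_inner_commutators: "F.subspace inner_commutators"
  unfolding F.subspace_def inner_commutators_def
proof (intro conjI ballI allI)
  note K = subspace_commutator_span[of UNIV]
  show "0 \<in> ad ` commutator_span UNIV"
    using subspace_0[OF K] ad_zero by (metis image_eqI)
  fix f assume "f \<in> ad ` commutator_span UNIV"
  then obtain x where x: "x \<in> commutator_span UNIV" "f = ad x" by blast
  show "fun_smul smul c f \<in> ad ` commutator_span UNIV" for c
    using subspace_scale[OF K x(1), of c] by (auto simp: x(2) ad_smul[symmetric])
  show "f + g \<in> ad ` commutator_span UNIV" if "g \<in> ad ` commutator_span UNIV" for g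
    using that subspace_add[OF K x(1)] by (auto simp: x(2) ad_add[symmetric])
qed

lemma closure_inner_commutators_ideal:
  "lie_ideal smul (Der smul) (Der smul \<inter> pointwise_closure inner_commutators)"
  unfolding lie_ideal_def
proof (intro conjI ballI)
  have Der: "F.subspace (Der smul)" "\<And>d f. d \<in> Der smul \<Longrightarrow> f \<in> Der smul \<Longrightarrow> commutator d f \<in> Der smul"
    using lie_subalgebra_Der by (auto simp: lie_subalgebra_def)
  show "F.subspace (Der smul \<inter> pointwise_closure inner_commutators)"
    by (intro F.subspace_inter Der subspace_pointwise_closure subspace_inner_commutators)
  fix d f assume d: "d \<in> Der smul" and "f \<in> Der smul \<inter> pointwise_closure inner_commutators"
  then have f: "f \<in> Der smul" "f \<in> pointwise_closure inner_commutators" by auto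
  have "commutator d f \<in> pointwise_closure inner_commutators"
    unfolding pointwise_closure_def
  proof (intro CollectI allI impI)
    fix S :: "'a set" assume "finite S"
    then obtain x where x: "x \<in> commutator_span UNIV" "\<forall>s\<in>S \<union> d ` S. f s = ad x s"
      using pointwise_closureD[OF f(2), of "S \<union> d ` S"] by (auto simp: inner_commutators_def)
    have "commutator d f s = ad (d x) s" if "s \<in> S" for s
      using x(2) that by (simp add: commutator_def Der_ad[OF d])
    then show "\<exists>g\<in>inner_commutators. \<forall>s\<in>S. commutator d f s = g s"
      using derivation_image_commutator_span[OF d x(1)] by (auto simp: inner_commutators_def)
  qed
  then show "commutator d f \<in> Der smul \<inter> pointwise_closure inner_commutators"
    using Der(2)[OF d f(1)] by blast
qed auto

end


section \<open>Systems of matrix units\<close>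

text \<open>
  A unital copy of a full matrix algebra is handled through its matrix units, indexed from 0, and
  not through an isomorphism; this keeps every computation inside the ambient ring. The last
  assumption excludes exactly the zero ring: if \<open>e 0 0\<close> vanishes, then so do all units
  \<open>e i 0 * e 0 0 * e 0 j\<close> and their diagonal sum 1.
\<close>

locale matrix_units = assoc_algebra smul
  for smul :: "'f::field \<Rightarrow> 'a::ring_1 \<Rightarrow> 'a" +
  fixes n :: nat and e :: "nat \<Rightarrow> nat \<Rightarrow> 'a"
  assumes size_pos: "0 < n"
    and unit_mult: "i < n \<Longrightarrow> j < n \<Longrightarrow> k < n \<Longrightarrow> l < n \<Longrightarrow>
      e i j * e k l = (if j = k then e i l else 0)"
    and sum_units: "(\<Sum>i<n. e i i) = 1"
    and unit_nonzero: "e 0 0 \<noteq> 0"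
begin

definition full :: "'a set" where
  "full = span {e i j |i j. i < n \<and> j < n}"

lemma subspace_full: "subspace full"
  by (simp add: full_def)

lemma unit_in_full: "i < n \<Longrightarrow> j < n \<Longrightarrow> e i j \<in> full"
  unfolding full_def by (intro span_base) blast

lemma full_induct [consumes 1, case_names subspace unit]:
  assumes "x \<in> full" "subspace {x. P x}" "\<And>i j. i < n \<Longrightarrow> j < n \<Longrightarrow> P (e i j)"
  shows "P x"
  using assms(1) unfolding full_def
  by (rule span_induct) (use assms in auto)

lemma full_mult:
  assumes "x \<in> full" "y \<in> full"
  shows "x * y \<in> full"
  using assms(1)
proof (induction rule: full_induct)
  case subspace
  show ?case using subspace_full
    by (auto simp: subspace_def distrib_right smul_mult_left)
next
  case (unit i j)
  show ?case using assms(2)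
  proof (induction rule: full_induct)
    case subspace
    show ?case using subspace_full
      by (auto simp: subspace_def distrib_left smul_mult_right)
  next
    case (unit k l)
    then show ?case using \<open>i < n\<close> \<open>j < n\<close> subspace_0[OF subspace_full]
      by (auto simp: unit_mult unit_in_full)
  qed
qed

text \<open>
  The product picks out the matrix entry of \<open>x\<close> in row \<open>j\<close> and column \<open>k\<close>. The existential form
  suffices, so coordinates of \<open>x\<close> need not be introduced.
\<close>

lemma corner_scalar:
  assumes "x \<in> full" "i < n" "j < n" "k < n" "l < n"
  shows "\<exists>c. e i j * x * e k l = smul c (e i l)"
  using assms(1)
proof (induction rule: full_induct)
  case subspace
  show ?case
    unfolding subspace_def
  proof (safe)
    show "\<exists>c. e i j * 0 * e k l = smul c (e i l)" by (rule exI[of _ 0]) simp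
  next
    fix x y c c'
    assume "e i j * x * e k l = smul c (e i l)" "e i j * y * e k l = smul c' (e i l)"
    then show "\<exists>c. e i j * (x + y) * e k l = smul c (e i l)"
      by (intro exI[of _ "c + c'"]) (simp add: distrib_left distrib_right scale_left_distrib)
  next
    fix b x c
    assume "e i j * x * e k l = smul c (e i l)"
    then show "\<exists>c. e i j * smul b x * e k l = smul c (e i l)"
      by (intro exI[of _ "b * c"]) (simp add: smul_mult_left smul_mult_right)
  qed
next
  case (unit a b)
  then have "e i j * e a b * e k l = smul (if j = a \<and> b = k then 1 else 0) (e i l)"
    using assms by (auto simp: unit_mult)
  then show ?case ..
qed

lemma peirce_decomposition: "x = (\<Sum>i<n. \<Sum>j<n. e i i * x * e j j)"
proof -
  have "x = 1 * x * 1" by simp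
  also have "\<dots> = (\<Sum>i<n. \<Sum>j<n. e i i * x * e j j)"
    unfolding sum_units[symmetric] by (simp add: sum_distrib_left sum_distrib_right) (rule sum.swap)
  finally show ?thesis .
qed

lemma unit_neq_0:
  assumes "i < n" "j < n" shows "e i j \<noteq> 0"
proof
  assume "e i j = 0"
  then have "e 0 i * e i j * e j 0 = 0" by simp
  then show False using assms size_pos unit_nonzero by (simp add: unit_mult)
qed

lemma off_diagonal_unit:
  "i < n \<Longrightarrow> j < n \<Longrightarrow> i \<noteq> j \<Longrightarrow> ad (e i i) (e i j) = e i j"
  by (simp add: ad_def unit_mult)

text \<open>
  The values of \<open>d\<close> may lie outside the matrix algebra. The averaging element
  \<open>a = (\<Sum>i<n. d (e i 0) * e 0 i)\<close> works: expanding \<open>d (e k l * e i 0)\<close> by the product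
  rule shows that \<open>e k l * a\<close> and \<open>a * e k l\<close> differ by \<open>d (e k l)\<close>.
\<close>

lemma derivation_inner_on_full:
  assumes d: "d \<in> Der smul"
  shows "\<exists>a. \<forall>x\<in>full. d x = ad a x"
proof (rule exI, rule ballI)
  let ?a = "\<Sum>i<n. d (e i 0) * e 0 i"
  fix x assume "x \<in> full"
  then show "d x = ad ?a x"
  proof (induction rule: full_induct)
    case subspace
    show ?case using d ad_in_Der[of ?a]
      by (auto simp: subspace_def Der_zero Der_add Der_smul)
  next
    case (unit k l)
    have "?a * e k l = (\<Sum>i<n. if i = k then d (e k 0) * e 0 l else 0)"
      unfolding sum_distrib_right using unit size_pos
      by (intro sum.cong) (auto simp: mult.assoc unit_mult)
    also have "\<dots> = d (e k 0) * e 0 l" using unit by simp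
    finally have left: "?a * e k l = d (e k 0) * e 0 l" .
    have "e k l * ?a = (\<Sum>i<n. d (e k l * e i 0) * e 0 i - d (e k l) * e i i)"
      using size_pos unit unfolding Der_mult[OF d]
      by (auto simp: sum_distrib_left algebra_simps unit_mult intro!: sum.cong)
    also have "\<dots> = (\<Sum>i<n. if i = l then d (e k 0) * e 0 l else 0) - d (e k l)"
      unfolding sum_subtractf sum_distrib_left[symmetric] sum_units
      using unit size_pos
      by (intro arg_cong2[of _ _ _ _ "(-)"] sum.cong) (auto simp: unit_mult Der_zero[OF d])
    also have "\<dots> = d (e k 0) * e 0 l - d (e k l)" using unit by simp
    finally show ?case by (simp add: ad_def left)
  qed
qed

text \<open>
  A unit \<open>e i j\<close> off the diagonal squares to 0, so a scalar value \<open>c\<close> of \<open>d\<close> there satisfies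
  \<open>2 c e i j = 0\<close> and vanishes; products of such units give the diagonal ones. Hence a derivation
  that is nonzero on the matrix algebra has a nonscalar value at an off-diagonal unit, which is a
  commutator.
\<close>

lemma derivation_eq_0_on_full:
  assumes d: "d \<in> Der smul" and two: "(2::'f) \<noteq> 0"
    and scalar: "\<And>i j. i < n \<Longrightarrow> j < n \<Longrightarrow> i \<noteq> j \<Longrightarrow> \<exists>c. d (e i j) = smul c 1"
    and "x \<in> full"
  shows "d x = 0"
proof -
  have off: "d (e i j) = 0" if ij: "i < n" "j < n" "i \<noteq> j" for i j
  proof -
    obtain c where c: "d (e i j) = smul c 1" using scalar ij by blast
    have "0 = d (e i j * e i j)" using ij by (simp add: unit_mult Der_zero[OF d])
    also have "\<dots> = smul c (e i j) + smul c (e i j)"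
      by (simp add: Der_mult[OF d] c smul_mult_left smul_mult_right)
    also have "\<dots> = smul (2 * c) (e i j)"
      by (simp only: scale_left_distrib mult_2)
    finally have "c = 0" using two unit_neq_0[of i j] ij by simp
    then show ?thesis by (simp add: c)
  qed
  have diag: "d (e i i) = 0" if i: "i < n" for i
  proof (cases "n = 1")
    case True
    then have "e i i = 1" using sum_units i by simp
    then show ?thesis using Der_mult[OF d, of 1 1] by simp
  next
    case False
    define j where "j = (if i = 0 then 1 else 0::nat)"
    have j: "j < n" "i \<noteq> j" using False size_pos by (auto simp: j_def)
    have "e i i = e i j * e j i" using i j by (simp add: unit_mult)
    then show ?thesis using off[OF i j] off[OF j(1) i] j by (simp add: Der_mult[OF d])
  qed
  from \<open>x \<in> full\<close> show ?thesis
  proof (induction rule: full_induct)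
    case subspace
    show ?case using d by (auto simp: subspace_def Der_zero Der_add Der_smul)
  next
    case (unit i j)
    then show ?case using off diag by (cases "i = j") auto
  qed
qed

end


section \<open>Lie ideals and commutators of a matrix algebra\<close>

context matrix_units
begin

text \<open>
  A diagonal matrix commuting with the off-diagonal units has equal diagonal entries: moving
  \<open>y\<close> past \<open>e 0 i\<close> turns its entry at \<open>i\<close> into its entry at 0.
\<close>

lemma diagonal_balanced_imp_scalar:
  assumes "y \<in> full"
    and off: "\<And>i j. i < n \<Longrightarrow> j < n \<Longrightarrow> i \<noteq> j \<Longrightarrow> e i i * y * e j j = 0"
    and diag: "\<And>i j. i < n \<Longrightarrow> j < n \<Longrightarrow> i \<noteq> j \<Longrightarrow> ad y (e i j) = 0"
  shows "\<exists>c. y = smul c 1"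
proof -
  obtain c where c: "e 0 0 * y * e 0 0 = smul c (e 0 0)"
    using corner_scalar[OF assms(1), of 0 0 0 0] size_pos by blast
  have diag_entry: "e i i * y * e i i = smul c (e i i)" if i: "i < n" for i
  proof (cases "i = 0")
    case False
    then have "e 0 i * y = y * e 0 i" using diag[of 0 i] i size_pos by (simp add: ad_def)
    have units: "e i 0 * e 0 i = e i i" "e i 0 * e 0 0 = e i 0" "e 0 0 * e 0 i = e 0 i"
        "e 0 i * e i i = e 0 i"
      using i size_pos by (simp_all add: unit_mult)
    have "e i i * y * e i i = e i 0 * (e 0 i * y) * e i i"
      by (simp add: mult.assoc[symmetric] units)
    also have "\<dots> = e i 0 * y * (e 0 i * e i i)"
      by (simp only: \<open>e 0 i * y = y * e 0 i\<close> mult.assoc)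
    also have "\<dots> = (e i 0 * e 0 0) * y * (e 0 0 * e 0 i)"
      by (simp only: units)
    also have "\<dots> = e i 0 * (e 0 0 * y * e 0 0) * e 0 i"
      by (simp only: mult.assoc)
    finally show ?thesis
      using i size_pos by (simp add: c smul_mult_left smul_mult_right unit_mult)
  qed (use c in simp)
  have "y = (\<Sum>i<n. \<Sum>j<n. if j = i then smul c (e i i) else 0)"
    by (subst peirce_decomposition) (intro sum.cong refl, use off diag_entry in auto)
  also have "\<dots> = smul c (\<Sum>i<n. e i i)" by (simp add: scale_sum_right)
  finally show ?thesis by (auto simp: sum_units)
qed

text \<open>
  A nonscalar \<open>y\<close> yields one off-diagonal unit in \<open>J\<close>: from an off-diagonal entry by bracketing
  twice with \<open>e i j\<close>, which leaves \<open>-2\<close> times that entry times \<open>e i j\<close>, and otherwise from two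
  different diagonal entries by bracketing once. One off-diagonal unit then generates all of them,
  and they generate all commutators.
  
  The ambient ring may be larger than \<open>full\<close>, and \<open>J\<close> need not be contained in \<open>full\<close>; this lets
  the lemma be applied to the preimage of an ideal of derivations under \<open>ad\<close>.
\<close>

lemma lie_ideal_contains_commutators:
  assumes two: "(2::'f) \<noteq> 0" and J: "subspace J"
    and ideal: "\<And>x a b. x \<in> J \<Longrightarrow> a \<in> full \<Longrightarrow> b \<in> full \<Longrightarrow> ad x (ad a b) \<in> J"
    and y: "y \<in> J" "y \<in> full" and nonscalar: "\<nexists>c. y = smul c 1"
  shows "commutator_span full \<subseteq> J"
proof -
  have bracket: "ad x (e i j) \<in> J" if "x \<in> J" "i < n" "j < n" "i \<noteq> j" for x i j
    using ideal[OF that(1), of "e i i" "e i j"] that by (simp add: off_diagonal_unit unit_in_full)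
  have scaled: "x \<in> J" if "smul c x \<in> J" "c \<noteq> 0" for c x
    using subspace_scale[OF J that(1), of "inverse c"] that(2) by simp
  have neg: "- x \<in> J \<Longrightarrow> x \<in> J" for x using subspace_neg[OF J, of "- x"] by simp
  have "\<exists>i j. i < n \<and> j < n \<and> i \<noteq> j \<and> e i j \<in> J"
  proof (cases "\<exists>i j. i < n \<and> j < n \<and> i \<noteq> j \<and> e j j * y * e i i \<noteq> 0")
    case True
    then obtain i j where ij: "i < n" "j < n" "i \<noteq> j" "e j j * y * e i i \<noteq> 0" by blast
    obtain c where c: "e j j * y * e i i = smul c (e j i)"
      using corner_scalar[OF y(2)] ij by blast
    have sq: "e i j * e i j = 0" using ij by (simp add: unit_mult)
    have "ad (ad y (e i j)) (e i j) = y * (e i j * e i j) - e i j * y * e i j - e i j * y * e i j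
        + (e i j * e i j) * y"
      by (simp add: ad_def algebra_simps)
    also have "\<dots> = - smul 2 (e i j * y * e i j)"
      using scale_left_distrib[of 1 1] by (simp add: sq)
    also have "e i j * y * e i j = (e i j * e j j) * y * (e i i * e i j)"
      using ij by (simp add: unit_mult)
    also have "\<dots> = e i j * (e j j * y * e i i) * e i j"
      by (simp only: mult.assoc)
    also have "\<dots> = smul c (e i j)"
      using ij by (simp add: c smul_mult_left smul_mult_right unit_mult)
    finally have "smul (2 * c) (e i j) \<in> J"
      using bracket[OF bracket[OF y(1) ij(1-3)] ij(1-3)] neg by simp
    moreover have "c \<noteq> 0" using c ij(4) by auto
    ultimately have "e i j \<in> J" using scaled[of "2 * c" "e i j"] two by simp
    then show ?thesis using ij by blast
  next
    case False
    then have off: "e i i * y * e j j = 0" if "i < n" "j < n" "i \<noteq> j" for i j using that by blast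
    obtain i j where ij: "i < n" "j < n" "i \<noteq> j" "ad y (e i j) \<noteq> 0"
      using diagonal_balanced_imp_scalar[OF y(2) off] nonscalar by blast
    have "y * e i j = (\<Sum>k<n. e k k * y * e i i) * e i j"
      using ij by (simp add: sum_distrib_right[symmetric] sum_units mult.assoc unit_mult)
    also have "(\<Sum>k<n. e k k * y * e i i) = (\<Sum>k<n. if k = i then e i i * y * e i i else 0)"
      using off ij by (intro sum.cong) auto
    also have "\<dots> = e i i * y * e i i" using ij by simp
    finally have l: "y * e i j = e i i * y * e i j" using ij by (simp add: mult.assoc unit_mult)
    have "e i j * y = e i j * (\<Sum>k<n. e j j * y * e k k)"
      using ij by (simp add: sum_distrib_left[symmetric] sum_units mult.assoc[symmetric] unit_mult)
    also have "(\<Sum>k<n. e j j * y * e k k) = (\<Sum>k<n. if k = j then e j j * y * e j j else 0)"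
      using off ij by (intro sum.cong) auto
    also have "\<dots> = e j j * y * e j j" using ij by simp
    finally have r: "e i j * y = e i j * y * e j j"
      using ij by (simp add: mult.assoc[symmetric] unit_mult)
    obtain c c' where "e i i * y * e i j = smul c (e i j)" "e i j * y * e j j = smul c' (e i j)"
      using corner_scalar[OF y(2)] ij by blast
    then have eq: "ad y (e i j) = smul (c - c') (e i j)"
      unfolding ad_def by (subst l, subst r) (simp add: scale_left_diff_distrib)
    then have "e i j \<in> J"
      using bracket[OF y(1) ij(1-3)] ij(4) scaled[of "c - c'" "e i j"] by auto
    then show ?thesis using ij by blast
  qed
  then obtain i j where ij: "i < n" "j < n" "i \<noteq> j" "e i j \<in> J" by blast
  \<comment> \<open>Brackets with units move one unit of \<open>J\<close> along its row, along its column and across the diagonal.\<close>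
  have right: "e i l \<in> J" if "e i j \<in> J" "i < n" "j < n" "l < n" "i \<noteq> l" "i \<noteq> j" for i j l
    using bracket[of "e i j" j l] that by (cases "j = l") (auto simp: ad_def unit_mult)
  have left: "e k j \<in> J" if "e i j \<in> J" "i < n" "j < n" "k < n" "k \<noteq> j" "i \<noteq> j" for i j k
    using bracket[of "e i j" k i] that by (cases "k = i") (auto simp: ad_def unit_mult intro: neg)
  have diag: "e k k - e l l \<in> J" if "e k l \<in> J" "k < n" "l < n" "k \<noteq> l" for k l
    using bracket[of "e k l" l k] that by (simp add: ad_def unit_mult)
  have "e j i \<in> J"
  proof -
    have "ad (e i i - e j j) (e j i) = - smul 2 (e j i)"
      using ij scale_left_distrib[of 1 1 "e j i"] by (simp add: ad_def unit_mult algebra_simps)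
    then have "smul 2 (e j i) \<in> J"
      using bracket[OF diag[OF ij(4) ij(1-3)], of j i] ij neg by simp
    then show ?thesis using two by (rule scaled)
  qed
  then have col: "e k i \<in> J" if "k < n" "k \<noteq> i" for k
    using left[of j i k] ij that by simp
  have off: "e k l \<in> J" if "k < n" "l < n" "k \<noteq> l" for k l
  proof (cases "k = i")
    case True then show ?thesis using right[of i j l] ij that by simp
  next
    case False then show ?thesis using right[of k i l] col[of k] ij that by simp
  qed
  have units: "ad (e i j) (e k l) \<in> J" if "i < n" "j < n" "k < n" "l < n" for i j k l
    using that off diag[of i j] subspace_0[OF J] off[of i j]
    by (cases "i = j") (auto simp: ad_def unit_mult intro: subspace_neg[OF J])
  show ?thesis
  proof (rule commutator_span_minimal[OF J])
    fix a b assume "a \<in> full" "b \<in> full"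
    from this(1) show "ad a b \<in> J"
    proof (induction rule: full_induct)
      case subspace
      show ?case using J by (auto simp: subspace_def ad_add ad_smul fun_smul_def)
          (simp add: ad_def)
    next
      case (unit i j)
      show ?case using \<open>b \<in> full\<close>
      proof (induction rule: full_induct)
        case subspace
        show ?case using J ad_in_Der[of "e i j"]
          by (auto simp: subspace_def Der_zero Der_add Der_smul)
      qed (use unit units in blast)
    qed
  qed
qed

text \<open>
  The coefficient \<open>t\<close> is the trace of \<open>a\<close>: off-diagonal units are commutators, and any two
  diagonal units differ by a commutator.
\<close>

lemma full_modulo_commutators:
  assumes "a \<in> full"
  shows "\<exists>t. a - smul t (e 0 0) \<in> commutator_span full"
  using assms
proof (induction rule: full_induct)
  case subspace
  let ?K = "commutator_span full"
  note K = subspace_commutator_span[of full]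
  show ?case
    unfolding subspace_def
  proof safe
    show "\<exists>t. 0 - smul t (e 0 0) \<in> ?K" by (rule exI[of _ 0]) (simp add: subspace_0[OF K])
  next
    fix x y t u assume "x - smul t (e 0 0) \<in> ?K" "y - smul u (e 0 0) \<in> ?K"
    from subspace_add[OF K this] show "\<exists>t. x + y - smul t (e 0 0) \<in> ?K"
      by (intro exI[of _ "t + u"]) (simp add: scale_left_distrib algebra_simps)
  next
    fix c x t assume "x - smul t (e 0 0) \<in> ?K"
    from subspace_scale[OF K this, of c] show "\<exists>t. smul c x - smul t (e 0 0) \<in> ?K"
      by (intro exI[of _ "c * t"]) (simp add: scale_right_diff_distrib)
  qed
next
  case (unit i j)
  show ?case
  proof (cases "i = j")
    case True
    have "ad (e i 0) (e 0 i) = e i j - smul 1 (e 0 0)"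
      using True unit size_pos by (simp add: ad_def unit_mult)
    then show ?thesis
      using ad_in_commutator_span[of "e i 0" full "e 0 i"] unit size_pos
      by (intro exI[of _ 1]) (simp add: unit_in_full)
  next
    case False
    then show ?thesis
      using ad_in_commutator_span[of "e i i" full "e i j"] unit
      by (intro exI[of _ 0]) (simp add: unit_in_full off_diagonal_unit)
  qed
qed

end


section \<open>Unital embeddings of matrix algebras\<close>

lemma (in vector_space) independent_family:
  fixes w :: "'i \<Rightarrow> 'b"
  assumes "finite I" and zero: "\<And>u i. (\<Sum>i\<in>I. scale (u i) (w i)) = 0 \<Longrightarrow> i \<in> I \<Longrightarrow> u i = 0"
  shows "inj_on w I" and "independent (w ` I)"
proof -
  show inj: "inj_on w I"
  proof (rule inj_onI, rule ccontr)
    fix i j assume ij: "i \<in> I" "j \<in> I" "w i = w j" "i \<noteq> j"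
    let ?u = "\<lambda>k. (if k = i then 1 else 0) - (if k = j then 1 else 0) :: 'a"
    have "(\<Sum>k\<in>I. scale (?u k) (w k)) = (\<Sum>k\<in>I. if k = i then w k else 0) - (\<Sum>k\<in>I. if k = j then w k else 0)"
      unfolding sum_subtractf[symmetric] by (intro sum.cong) (auto simp: scale_left_diff_distrib)
    also have "\<dots> = 0" using assms(1) ij by simp
    finally have "?u i = 0" using zero[of ?u i] ij(1) by blast
    then show False using ij(4) by simp
  qed
  show "independent (w ` I)"
  proof (rule independent_if_scalars_zero)
    show "finite (w ` I)" using assms(1) by simp
    fix f x assume "(\<Sum>x\<in>w ` I. scale (f x) x) = 0" "x \<in> w ` I"
    then show "f x = 0"
      using zero[of "\<lambda>i. f (w i)"] by (auto simp: sum.reindex[OF inj])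
  qed
qed

context matrix_units
begin

text \<open>
  The elements \<open>v\<close> in question form the first column of the matrix algebra, its simple left
  module. The coefficients are given together with the equation that recovers them.
\<close>

lemma column_expansion:
  assumes "v \<in> full" "v * e 0 0 = v"
  shows "\<exists>c. (\<forall>k<n. e 0 k * v = smul (c k) (e 0 0)) \<and> v = (\<Sum>k<n. smul (c k) (e k 0))"
proof -
  have "\<exists>c. e 0 k * v = smul c (e 0 0)" if "k < n" for k
    using corner_scalar[OF assms(1), of 0 k 0 0] that size_pos assms(2) by (simp add: mult.assoc)
  then obtain c where c: "\<forall>k<n. e 0 k * v = smul (c k) (e 0 0)" by metis
  have "v = (\<Sum>k<n. e k k) * v" by (simp add: sum_units)
  also have "\<dots> = (\<Sum>k<n. e k 0 * (e 0 k * v))"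
    unfolding sum_distrib_right using size_pos
    by (intro sum.cong) (simp_all add: mult.assoc[symmetric] unit_mult)
  also have "\<dots> = (\<Sum>k<n. smul (c k) (e k 0))"
    using c size_pos by (intro sum.cong) (simp_all add: smul_mult_right unit_mult)
  finally show ?thesis using c by blast
qed

lemma column_independent:
  "inj_on (\<lambda>k. e k 0) {..<n}" "independent ((\<lambda>k. e k 0) ` {..<n})"
proof -
  have zero: "u i = 0" if 0: "(\<Sum>k<n. smul (u k) (e k 0)) = 0" and i: "i \<in> {..<n}" for u i
  proof -
    have "e 0 i * (\<Sum>k<n. smul (u k) (e k 0)) = (\<Sum>k<n. if k = i then smul (u i) (e 0 0) else 0)"
      unfolding sum_distrib_left using i size_pos
      by (intro sum.cong) (auto simp: smul_mult_right unit_mult)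
    also have "\<dots> = smul (u i) (e 0 0)" using i by simp
    finally show ?thesis using 0 unit_nonzero by simp
  qed
  show "inj_on (\<lambda>k. e k 0) {..<n}" "independent ((\<lambda>k. e k 0) ` {..<n})"
    by (rule independent_family[OF finite_lessThan], erule (1) zero)+
qed

lemma smul_of_nat: "smul (of_nat k) x = of_nat k * x"
  by (induction k) (simp_all add: scale_left_distrib distrib_right)

text \<open>
  Let \<open>V\<close> be the first column of the large algebra, of dimension \<open>n\<close>, and \<open>W = g 0 0 * V\<close>. The units
  \<open>g i 0\<close> identify \<open>V\<close> with \<open>m\<close> copies of \<open>W\<close>, so \<open>n = m * r\<close> for \<open>r = dim W\<close>. For a basis \<open>B\<close> of
  \<open>W\<close>, the coordinate functionals are realised by row vectors \<open>u b\<close>, so that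
  \<open>g 0 0 = (\<Sum>b\<in>B. b * u b)\<close> while \<open>u b * b = e 0 0\<close>. Exchanging the factors replaces
  \<open>g 0 0\<close> by \<open>r\<close> copies of \<open>e 0 0\<close>, at the cost of commutators only. This is the fact that the trace
  of an idempotent is its rank, in a form that also shows what the trace controls.
\<close>

lemma embedded_matrix_units:
  assumes D: "matrix_units smul m g" and sub: "\<And>i j. i < m \<Longrightarrow> j < m \<Longrightarrow> g i j \<in> full"
  shows "\<exists>r. n = m * r \<and> g 0 0 - smul (of_nat r) (e 0 0) \<in> commutator_span full"
proof -
  interpret D: matrix_units smul m g by (rule D)
  let ?col = "(\<lambda>k. e k 0) ` {..<n}"
  define V where "V = {v \<in> full. v * e 0 0 = v}"
  define W where "W = {v \<in> V. g 0 0 * v = v}"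
  note m = D.size_pos and n = size_pos
  have V_mult: "x * v \<in> V" if "x \<in> full" "v \<in> V" for x v
    using that by (auto simp: V_def full_mult mult.assoc)
  have col_V: "e k 0 \<in> V" if "k < n" for k
    using that n by (auto simp: V_def unit_in_full unit_mult)
  have V_col: "V \<subseteq> span ?col"
  proof
    fix v assume "v \<in> V"
    then obtain c where c: "v = (\<Sum>k<n. smul (c k) (e k 0))"
      using column_expansion unfolding V_def by blast
    show "v \<in> span ?col"
      unfolding c by (intro span_sum span_scale span_base imageI) simp
  qed
  obtain B where B: "B \<subseteq> W" "independent B" "W \<subseteq> span B"
    using maximal_independent_subset by blast
  have BW: "b \<in> V" "g 0 0 * b = b" if "b \<in> B" for b
    using B(1) that by (auto simp: W_def)
  have "B \<subseteq> span ?col" using B(1) V_col by (auto simp: W_def)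
  from independent_span_bound[OF _ B(2) this] have fin: "finite B" by simp
  let ?w = "\<lambda>(i, b). g i 0 * b" and ?I = "{..<m} \<times> B"
  have zero: "u p = 0" if 0: "(\<Sum>p\<in>?I. smul (u p) (?w p)) = 0" and p: "p \<in> ?I" for u p
  proof -
    obtain j b where jb: "p = (j, b)" "j < m" "b \<in> B" using p by auto
    have "0 = g 0 j * (\<Sum>(i, b)\<in>?I. smul (u (i, b)) (g i 0 * b))"
      using 0 by (simp add: case_prod_unfold)
    also have "\<dots> = g 0 j * (\<Sum>i<m. \<Sum>b\<in>B. smul (u (i, b)) (g i 0 * b))"
      by (simp add: sum.cartesian_product)
    also have "\<dots> = (\<Sum>i<m. if i = j then \<Sum>b\<in>B. smul (u (j, b)) b else 0)"
      unfolding sum_distrib_left using jb m BW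
      by (intro sum.cong) (auto simp: smul_mult_right mult.assoc[symmetric] D.unit_mult)
    also have "\<dots> = (\<Sum>b\<in>B. smul (u (j, b)) b)" using jb by simp
    finally have "(\<Sum>b\<in>B. smul (u (j, b)) b) = 0" by simp
    from independentD[OF B(2) fin _ this jb(3)] show ?thesis by (simp add: jb)
  qed
  have fin_I: "finite ?I" using fin by simp
  have family: "inj_on ?w ?I" "independent (?w ` ?I)"
    by (rule independent_family[OF fin_I], erule (1) zero)+
  have "g i 0 * x \<in> span (?w ` ?I)" if "i < m" "x \<in> span B" for i x
    using that(2)
  proof (induction rule: span_induct)
    case base
    show ?case by (auto simp: subspace_def distrib_left smul_mult_right span_zero span_add span_scale)
  next
    case (step b)
    then show ?case using that(1) by (intro span_base) force
  qed
  note lift = this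
  have V_w: "V \<subseteq> span (?w ` ?I)"
  proof
    fix v assume v: "v \<in> V"
    have "v = (\<Sum>i<m. g i i) * v" by (simp add: D.sum_units)
    also have "\<dots> = (\<Sum>i<m. g i 0 * (g 0 i * v))"
      unfolding sum_distrib_right using m
      by (intro sum.cong) (simp_all add: mult.assoc[symmetric] D.unit_mult)
    finally have eq: "v = (\<Sum>i<m. g i 0 * (g 0 i * v))" .
    have "g 0 i * v \<in> W" if "i < m" for i
      using that m V_mult[OF sub v] by (simp add: W_def mult.assoc[symmetric] D.unit_mult)
    then have "g i 0 * (g 0 i * v) \<in> span (?w ` ?I)" if "i < m" for i
      using that B(3) by (intro lift) auto
    then show "v \<in> span (?w ` ?I)" by (subst eq) (auto intro: span_sum)
  qed
  have "?w ` ?I \<subseteq> V" using V_mult[OF sub] BW(1) m by auto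
  then have "card (?w ` ?I) \<le> card ?col"
    using independent_span_bound[OF _ family(2), of ?col] V_col by auto
  moreover have "card ?col \<le> card (?w ` ?I)"
    using independent_span_bound[OF finite_imageI[OF fin_I] column_independent(2), of ?w] V_w col_V
    by auto
  ultimately have size: "n = m * card B"
    using card_image[OF family(1)] card_image[OF column_independent(1)]
    by (simp add: card_cartesian_product)
  \<comment> \<open>The row vector whose product with a column vector \<open>v\<close> is the \<open>b\<close>-coordinate of \<open>g 0 0 * v\<close>.\<close>
  define u where "u b = (\<Sum>k<n. smul (representation B (g 0 0 * e k 0) b) (e 0 k))" for b
  have gW: "g 0 0 * e k 0 \<in> W" if "k < n" for k
    using V_mult[OF sub[OF m m] col_V[OF that]] m
    by (simp add: W_def mult.assoc[symmetric] D.unit_mult)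
  have "(\<Sum>b\<in>B. b * u b) =
      (\<Sum>k<n. (\<Sum>b\<in>B. smul (representation B (g 0 0 * e k 0) b) b) * e 0 k)"
    unfolding u_def sum_distrib_left sum_distrib_right
    by (subst sum.swap) (simp add: smul_mult_left smul_mult_right)
  also have "\<dots> = (\<Sum>k<n. g 0 0 * e k 0 * e 0 k)"
    using sum_representation_eq[OF B(2) subsetD[OF B(3) gW] fin subset_refl]
    by (intro sum.cong) simp_all
  also have "\<dots> = g 0 0 * (\<Sum>k<n. e k k)"
    unfolding sum_distrib_left using n by (intro sum.cong) (auto simp: mult.assoc unit_mult)
  finally have resolution: "g 0 0 = (\<Sum>b\<in>B. b * u b)" by (simp add: sum_units)
  have dual: "u b * b = e 0 0" if b: "b \<in> B" for b
  proof -
    have "b \<in> full" "b * e 0 0 = b" using BW(1)[OF b] by (auto simp: V_def)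
    then obtain c where c: "\<forall>k<n. e 0 k * b = smul (c k) (e 0 0)"
      "b = (\<Sum>k<n. smul (c k) (e k 0))"
      using column_expansion by blast
    let ?r = "\<lambda>x. representation B x b"
    have in_span: "g 0 0 * e k 0 \<in> span B" if "k < n" for k
      using gW[OF that] B(3) by blast
    have "b = (\<Sum>k<n. smul (c k) (g 0 0 * e k 0))"
      using arg_cong[OF c(2), of "\<lambda>x. g 0 0 * x"] BW(2)[OF b]
      by (simp add: sum_distrib_left smul_mult_right)
    from arg_cong[OF this, of ?r]
    have "?r b = ?r (\<Sum>k<n. smul (c k) (g 0 0 * e k 0))" .
    also have "\<dots> = (\<Sum>k<n. ?r (smul (c k) (g 0 0 * e k 0)))"
      by (subst representation_sum[OF B(2)]) (auto intro: span_scale in_span)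
    also have "\<dots> = (\<Sum>k<n. c k * ?r (g 0 0 * e k 0))"
      by (intro sum.cong) (simp_all add: representation_scale[OF B(2)] in_span)
    finally have "?r b = (\<Sum>k<n. c k * ?r (g 0 0 * e k 0))" .
    moreover have "representation B b b = 1"
      using representation_basis[OF B(2) b] by simp
    moreover have "u b * b = smul (\<Sum>k<n. c k * representation B (g 0 0 * e k 0) b) (e 0 0)"
      unfolding u_def sum_distrib_right scale_sum_left
      using c(1) by (intro sum.cong) (auto simp: smul_mult_left mult.commute)
    ultimately show ?thesis by simp
  qed
  have u_full: "u b \<in> full" for b
    unfolding u_def using n
    by (intro subspace_sum[OF subspace_full] subspace_scale[OF subspace_full] unit_in_full) auto
  have "(\<Sum>b\<in>B. ad b (u b)) = g 0 0 - smul (of_nat (card B)) (e 0 0)"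
    by (simp add: ad_def sum_subtractf dual resolution smul_of_nat)
  moreover have "(\<Sum>b\<in>B. ad b (u b)) \<in> commutator_span full"
    using BW(1) u_full
    by (intro subspace_sum[OF subspace_commutator_span] ad_in_commutator_span) (auto simp: V_def)
  ultimately show ?thesis using size by (intro exI[of _ "card B"]) simp
qed

end


section \<open>Traces\<close>

context matrix_units
begin

text \<open>
  The usual trace of \<open>x\<close> times the idempotent \<open>e 0 0\<close>. Taking values in the corner avoids choosing
  coordinates.
\<close>

definition corner_trace :: "'a \<Rightarrow> 'a" where
  "corner_trace x = (\<Sum>k<n. e 0 k * x * e k 0)"

lemma corner_trace_add: "corner_trace (x + y) = corner_trace x + corner_trace y"
  by (simp add: corner_trace_def distrib_left distrib_right sum.distrib)

lemma corner_trace_zero: "corner_trace 0 = 0"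
  by (simp add: corner_trace_def)

lemma corner_trace_smul: "corner_trace (smul c x) = smul c (corner_trace x)"
  by (simp add: corner_trace_def smul_mult_left smul_mult_right scale_sum_right)

lemma corner_trace_diff: "corner_trace (x - y) = corner_trace x - corner_trace y"
  using corner_trace_add[of "x - y" y] by simp

lemma corner_trace_sum: "corner_trace (\<Sum>i\<in>I. f i) = (\<Sum>i\<in>I. corner_trace (f i))"
  by (induction I rule: infinite_finite_induct) (auto simp: corner_trace_zero corner_trace_add)

lemma corner_trace_unit: "corner_trace (e 0 0) = e 0 0"
proof -
  have "corner_trace (e 0 0) = (\<Sum>k<n. if k = 0 then e 0 0 else 0)"
    unfolding corner_trace_def using size_pos by (intro sum.cong) (auto simp: unit_mult)
  also have "\<dots> = e 0 0" using size_pos by simp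
  finally show ?thesis .
qed

text \<open>
  Inserting \<open>1 = (\<Sum>l<n. e l 0 * e 0 l)\<close> between the factors splits each summand into a product of
  two elements of the corner of \<open>e 0 0\<close>, and that corner is one-dimensional, hence commutative.
\<close>

lemma corner_trace_mult_commute:
  assumes "x \<in> full" "y \<in> full"
  shows "corner_trace (x * y) = corner_trace (y * x)"
proof -
  have expand: "corner_trace (a * b) = (\<Sum>k<n. \<Sum>l<n. (e 0 k * a * e l 0) * (e 0 l * b * e k 0))"
    for a b
  proof -
    have "corner_trace (a * b) = (\<Sum>k<n. e 0 k * a * (\<Sum>l<n. e l l) * b * e k 0)"
      by (simp add: corner_trace_def sum_units mult.assoc)
    also have "\<dots> = (\<Sum>k<n. e 0 k * a * (\<Sum>l<n. e l 0 * e 0 l) * b * e k 0)"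
      using size_pos by (simp add: unit_mult)
    finally show ?thesis by (simp add: sum_distrib_left sum_distrib_right mult.assoc)
  qed
  have "(e 0 k * x * e l 0) * (e 0 l * y * e k 0) = (e 0 l * y * e k 0) * (e 0 k * x * e l 0)"
    if kl: "k < n" "l < n" for k l
  proof -
    obtain c where "e 0 k * x * e l 0 = smul c (e 0 0)"
      using corner_scalar[OF assms(1), of 0 k l 0] size_pos kl by auto
    moreover obtain d where "e 0 l * y * e k 0 = smul d (e 0 0)"
      using corner_scalar[OF assms(2), of 0 l k 0] size_pos kl by auto
    ultimately show ?thesis by (simp add: smul_mult_left smul_mult_right mult.commute)
  qed
  then show ?thesis unfolding expand by (subst sum.swap) simp
qed

lemma corner_trace_commutator_span:
  assumes "x \<in> commutator_span full" shows "corner_trace x = 0"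
proof -
  have "commutator_span full \<subseteq> {x. corner_trace x = 0}"
    by (intro commutator_span_minimal)
      (auto simp: subspace_def corner_trace_zero corner_trace_add corner_trace_smul
        corner_trace_diff ad_def intro: corner_trace_mult_commute)
  with assms show ?thesis by blast
qed

text \<open>
  The diagonal units of the small algebra are conjugate by units that commute with \<open>z\<close>, so the \<open>m\<close>
  blocks of \<open>z\<close> have the same trace. In particular the trace vanishes if \<open>m\<close> is zero in the
  field.
\<close>

lemma corner_trace_centralizer:
  assumes D: "matrix_units smul m g" and sub: "\<And>i j. i < m \<Longrightarrow> j < m \<Longrightarrow> g i j \<in> full"
    and z: "z \<in> full" "\<And>i j. i < m \<Longrightarrow> j < m \<Longrightarrow> g i j * z = z * g i j"
  shows "corner_trace z = of_nat m * corner_trace (g 0 0 * z)"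
proof -
  interpret D: matrix_units smul m g by (rule D)
  have "corner_trace (g i i * z) = corner_trace (g 0 0 * z)" if i: "i < m" for i
  proof -
    have "g i i * z = g i 0 * (z * g 0 i)"
      using i D.size_pos by (simp add: z(2)[symmetric] mult.assoc[symmetric] D.unit_mult)
    also have "corner_trace \<dots> = corner_trace (z * g 0 i * g i 0)"
      using i D.size_pos sub z(1) by (intro corner_trace_mult_commute) (simp_all add: full_mult)
    also have "z * g 0 i * g i 0 = g 0 0 * z"
      using i D.size_pos by (simp add: mult.assoc z(2) D.unit_mult)
    finally show ?thesis .
  qed
  note diag = this
  have "corner_trace z = (\<Sum>i<m. corner_trace (g i i * z))"
    by (simp add: corner_trace_sum[symmetric] sum_distrib_right[symmetric] D.sum_units)
  also have "\<dots> = (\<Sum>i<m. corner_trace (g 0 0 * z))"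
    by (rule sum.cong[OF refl]) (rule diag, simp)
  finally show ?thesis by simp
qed

end


section \<open>Matrix units in locally matrix algebras\<close>

text \<open>
  The units are the preimages of the elementary matrices; equations between them are checked on
  matrix entries.
\<close>

lemma matrix_units_of_iso:
  fixes smul :: "'f::field \<Rightarrow> 'a::ring_1 \<Rightarrow> 'a"
  assumes "assoc_algebra smul" and B: "subalgebra smul B" "1 \<in> B" and n: "0 < n"
    and iso: "iso_matrix_algebra smul B n"
  shows "\<exists>e. matrix_units smul n e \<and> matrix_units.full smul n e = B"
proof -
  interpret assoc_algebra smul by (rule assms(1))
  have sub: "subspace B" and B_mult: "\<And>x y. x \<in> B \<Longrightarrow> y \<in> B \<Longrightarrow> x * y \<in> B"
    using B(1) by (auto simp: subalgebra_def)
  obtain \<phi> :: "'a \<Rightarrow> 'f mat" where bij: "bij_betw \<phi> B (carrier_mat n n)"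
    and \<phi>_add: "\<And>x y. x \<in> B \<Longrightarrow> y \<in> B \<Longrightarrow> \<phi> (x + y) = \<phi> x + \<phi> y"
    and \<phi>_smul: "\<And>c x. x \<in> B \<Longrightarrow> \<phi> (smul c x) = c \<cdot>\<^sub>m \<phi> x"
    and \<phi>_mult: "\<And>x y. x \<in> B \<Longrightarrow> y \<in> B \<Longrightarrow> \<phi> (x * y) = \<phi> x * \<phi> y"
    using iso unfolding iso_matrix_algebra_def by blast
  have carrier: "\<phi> x \<in> carrier_mat n n" if "x \<in> B" for x
    using bij that by (auto simp: bij_betw_def)
  have dims: "dim_row (\<phi> x) = n" "dim_col (\<phi> x) = n" if "x \<in> B" for x
    using carrier[OF that] by auto
  have eqI: "x = y"
    if "x \<in> B" "y \<in> B" "\<And>a b. a < n \<Longrightarrow> b < n \<Longrightarrow> \<phi> x $$ (a, b) = \<phi> y $$ (a, b)" for x y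
  proof -
    have "\<phi> x = \<phi> y" using that dims by (intro eq_matI) auto
    then show ?thesis using bij that(1,2) by (auto simp: bij_betw_def inj_on_def)
  qed
  have zero_B: "0 \<in> B" by (rule subspace_0[OF sub])
  have \<phi>_zero: "\<phi> 0 $$ (a, b) = 0" if "a < n" "b < n" for a b
  proof -
    have "\<phi> 0 $$ (a, b) = (0 \<cdot>\<^sub>m \<phi> 0) $$ (a, b)" using \<phi>_smul[OF zero_B, of 0] by simp
    also have "\<dots> = 0" using that dims[OF zero_B] by simp
    finally show ?thesis .
  qed
  have \<phi>_sum: "\<phi> (\<Sum>i\<in>I. g i) $$ (a, b) = (\<Sum>i\<in>I. \<phi> (g i) $$ (a, b))"
    if "\<And>i. i \<in> I \<Longrightarrow> g i \<in> B" "a < n" "b < n" for g :: "nat \<Rightarrow> 'a" and I a b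
    using that(1)
  proof (induction I rule: infinite_finite_induct)
    case (insert i I)
    have "(\<Sum>i\<in>I. g i) \<in> B" using insert.prems by (intro subspace_sum[OF sub]) auto
    then have "\<phi> (g i + (\<Sum>i\<in>I. g i)) $$ (a, b) = \<phi> (g i) $$ (a, b) + \<phi> (\<Sum>i\<in>I. g i) $$ (a, b)"
      using insert.prems that(2,3) by (simp add: \<phi>_add dims)
    then show ?case using insert by simp
  qed (use that \<phi>_zero in auto)
  define E :: "nat \<Rightarrow> nat \<Rightarrow> 'f mat" where
    "E i j = mat n n (\<lambda>(a, b). if a = i \<and> b = j then 1 else 0)" for i j
  define e where "e i j = inv_into B \<phi> (E i j)" for i j
  have E_carrier: "E i j \<in> carrier_mat n n" for i j by (simp add: E_def)
  have e_B: "e i j \<in> B" for i j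
    unfolding e_def using bij E_carrier by (metis bij_betw_def inv_into_into)
  have \<phi>_e: "\<phi> (e i j) = E i j" for i j
    unfolding e_def by (rule bij_betw_inv_into_right[OF bij E_carrier])
  have entry: "\<phi> (e i j) $$ (a, b) = (if a = i \<and> b = j then 1 else 0)" if "a < n" "b < n" for i j a b
    using that by (simp add: \<phi>_e E_def)
  have mult: "e i j * e k l = (if j = k then e i l else 0)"
    if "i < n" "j < n" "k < n" "l < n" for i j k l
  proof (rule eqI)
    show "e i j * e k l \<in> B" "(if j = k then e i l else 0) \<in> B"
      using e_B B_mult zero_B by auto
    fix a b assume ab: "a < n" "b < n"
    have "\<phi> (e i j * e k l) $$ (a, b) = (\<Sum>c<n. E i j $$ (a, c) * E k l $$ (c, b))"
      using ab by (simp add: \<phi>_mult e_B \<phi>_e E_def scalar_prod_def lessThan_atLeast0)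
    also have "\<dots> = (\<Sum>c<n. if c = j then (if a = i \<and> b = l \<and> j = k then 1 else 0) else 0)"
      using ab by (intro sum.cong) (auto simp: E_def)
    also have "\<dots> = \<phi> (if j = k then e i l else 0) $$ (a, b)"
      using ab that by (simp add: entry \<phi>_zero)
    finally show "\<phi> (e i j * e k l) $$ (a, b) = \<phi> (if j = k then e i l else 0) $$ (a, b)" .
  qed
  have \<phi>_one: "\<phi> 1 = 1\<^sub>m n"
  proof -
    have "1\<^sub>m n \<in> \<phi> ` B" using bij by (simp add: bij_betw_def)
    then obtain x where x: "x \<in> B" "\<phi> x = 1\<^sub>m n" by auto
    then have "\<phi> (1 * x) = \<phi> 1 * 1\<^sub>m n" using \<phi>_mult[OF B(2) x(1)] by simp
    then show ?thesis using x right_mult_one_mat[OF carrier[OF B(2)]] by simp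
  qed
  have sum_e: "(\<Sum>i<n. e i i) = 1"
  proof (rule eqI)
    show "(\<Sum>i<n. e i i) \<in> B" using e_B by (intro subspace_sum[OF sub])
    fix a b assume "a < n" "b < n"
    then have "\<phi> (\<Sum>i<n. e i i) $$ (a, b) = (\<Sum>i<n. \<phi> (e i i) $$ (a, b))"
      by (intro \<phi>_sum e_B)
    also have "\<dots> = (\<Sum>i<n. if i = a then (if a = b then 1 else 0) else 0)"
      using entry[OF \<open>a < n\<close> \<open>b < n\<close>] by (intro sum.cong) auto
    finally show "\<phi> (\<Sum>i<n. e i i) $$ (a, b) = \<phi> 1 $$ (a, b)"
      using \<open>a < n\<close> \<open>b < n\<close> by (simp add: \<phi>_one)
  qed (rule B(2))
  have "e 0 0 \<noteq> 0" using entry[OF n n, of 0 0] \<phi>_zero[OF n n] by auto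
  then interpret matrix_units smul n e
    using n mult sum_e by unfold_locales auto
  have "full = B"
  proof
    show "full \<subseteq> B" unfolding full_def using e_B by (intro span_minimal sub) auto
    show "B \<subseteq> full"
    proof
      fix x assume x: "x \<in> B"
      let ?y = "\<Sum>i<n. \<Sum>j<n. smul (\<phi> x $$ (i, j)) (e i j)"
      have B_row: "(\<Sum>j<n. smul (\<phi> x $$ (i, j)) (e i j)) \<in> B" for i
        using e_B by (intro subspace_sum[OF sub] subspace_scale[OF sub])
      have "x = ?y"
      proof (rule eqI[OF x])
        show "?y \<in> B" by (rule subspace_sum[OF sub]) (rule B_row)
        fix a b assume ab: "a < n" "b < n"
        have "\<phi> ?y $$ (a, b) = (\<Sum>i<n. \<phi> (\<Sum>j<n. smul (\<phi> x $$ (i, j)) (e i j)) $$ (a, b))"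
          by (rule \<phi>_sum[OF B_row ab])
        also have "\<dots> = (\<Sum>i<n. \<Sum>j<n. \<phi> (smul (\<phi> x $$ (i, j)) (e i j)) $$ (a, b))"
          by (intro sum.cong refl \<phi>_sum subspace_scale[OF sub] e_B ab)
        also have "\<dots> = (\<Sum>i<n. \<Sum>j<n. if j = b then (if i = a then \<phi> x $$ (a, b) else 0) else 0)"
          using ab by (intro sum.cong) (auto simp: \<phi>_smul e_B dims entry)
        also have "\<dots> = \<phi> x $$ (a, b)" using ab by simp
        finally show "\<phi> x $$ (a, b) = \<phi> ?y $$ (a, b)" by simp
      qed
      also have "?y \<in> full"
        by (intro subspace_sum[OF subspace_full] subspace_scale[OF subspace_full] unit_in_full) auto
      finally show "x \<in> full" .
    qed
  qed
  then show ?thesis using matrix_units_axioms by blast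
qed

locale unital_locally_matrix_algebra = locally_matrix_algebra smul
  for smul :: "'f::field \<Rightarrow> 'a::ring_1 \<Rightarrow> 'a"
begin

lemma matrix_units_of_degree:
  assumes "n \<in> unital_matrix_degrees smul"
  shows "\<exists>e. matrix_units smul n e"
  using assms matrix_units_of_iso[OF assoc_algebra_axioms]
  by (auto simp: unital_matrix_degrees_def)

lemma finite_subset_of_full:
  assumes "finite S"
  shows "\<exists>n e. matrix_units smul n e \<and> n \<in> unital_matrix_degrees smul \<and>
    S \<subseteq> matrix_units.full smul n e"
proof -
  obtain B n where B: "insert 1 S \<subseteq> B" "subalgebra smul B" "0 < n" "iso_matrix_algebra smul B n"
    using locally_matrix[of "insert 1 S"] assms by blast
  then obtain e where "matrix_units smul n e" "matrix_units.full smul n e = B"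
    using matrix_units_of_iso[OF assoc_algebra_axioms B(2) _ B(3,4)] by blast
  moreover have "n \<in> unital_matrix_degrees smul"
    using B by (auto simp: unital_matrix_degrees_def)
  ultimately show ?thesis using B(1) by blast
qed

text \<open>
  The implementing element may fall outside the matrix algebra that contains \<open>S\<close>; a second, larger
  matrix algebra is chosen to contain it, and its degree is the relevant one.
\<close>

lemma derivation_inner_on_finite:
  assumes "d \<in> Der smul" "finite S"
  shows "\<exists>n e a. matrix_units smul n e \<and> n \<in> unital_matrix_degrees smul \<and>
    a \<in> matrix_units.full smul n e \<and> (\<forall>x\<in>S. d x = ad a x)"
proof -
  obtain n e where e: "matrix_units smul n e" "S \<subseteq> matrix_units.full smul n e"
    using finite_subset_of_full[OF assms(2)] by blast
  then obtain a where "\<forall>x\<in>S. d x = ad a x"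
    using matrix_units.derivation_inner_on_full[OF e(1) assms(1)] by blast
  then show ?thesis using finite_subset_of_full[of "{a}"] by auto
qed

end


section \<open>Density of inner derivations and the derived algebra\<close>

context unital_locally_matrix_algebra
begin

text \<open>
  If \<open>d\<close> and \<open>f\<close> agree with \<open>ad a\<close> and \<open>ad b\<close> on \<open>S\<close> and on the images of \<open>S\<close> under the other
  derivation, then on \<open>S\<close> their bracket agrees with \<open>ad (ad a b)\<close>.
\<close>

lemma lie_derived_Der_subset_closure:
  "lie_derived smul (Der smul) \<subseteq> pointwise_closure inner_commutators"
  unfolding lie_derived_def
proof (rule F.span_minimal)
  show "F.subspace (pointwise_closure inner_commutators)"
    by (intro subspace_pointwise_closure subspace_inner_commutators)
  show "{commutator d f |d f. d \<in> Der smul \<and> f \<in> Der smul} \<subseteq> pointwise_closure inner_commutators"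
  proof safe
    fix d f assume d: "d \<in> Der smul" and f: "f \<in> Der smul"
    show "commutator d f \<in> pointwise_closure inner_commutators"
      unfolding pointwise_closure_def
    proof (intro CollectI allI impI)
      fix S :: "'a set" assume S: "finite S"
      obtain a where a: "\<forall>x\<in>S \<union> f ` S. d x = ad a x"
        using derivation_inner_on_finite[OF d, of "S \<union> f ` S"] S by blast
      obtain b where b: "\<forall>x\<in>S \<union> d ` S. f x = ad b x"
        using derivation_inner_on_finite[OF f, of "S \<union> d ` S"] S by blast
      have "commutator d f s = ad (ad a b) s" if s: "s \<in> S" for s
      proof -
        have "commutator d f s = ad a (f s) - ad b (d s)" using a b s by (simp add: commutator_def)
        also have "\<dots> = ad a (ad b s) - ad b (ad a s)" using a b s by simp
        finally show ?thesis using Der_ad[OF ad_in_Der[of a], of b s] by simp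
      qed
      then show "\<exists>g\<in>inner_commutators. \<forall>s\<in>S. commutator d f s = g s"
        using ad_in_commutator_span[of a UNIV b] by (auto simp: inner_commutators_def)
    qed
  qed
qed

text \<open>
  The set \<open>J\<close> of all \<open>x\<close> with \<open>ad x \<in> I\<close> is closed under brackets with commutators. It contains
  \<open>d (e i j)\<close> for every \<open>d \<in> I\<close> and every off-diagonal unit, and one of these values is not scalar.
  Inside a matrix algebra containing that value and two given elements, the matrix statement puts
  the commutator of the two elements into \<open>J\<close>.
\<close>

lemma nonzero_ideal_contains_inner_commutators:
  assumes two: "(2::'f) \<noteq> 0" and ideal: "lie_ideal smul L I" "I \<noteq> {0}"
    and L: "L \<subseteq> Der smul" "inner_commutators \<subseteq> L"
  shows "inner_commutators \<subseteq> I"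
proof -
  have I: "F.subspace I" "I \<subseteq> L" and bracket: "\<And>d f. d \<in> L \<Longrightarrow> f \<in> I \<Longrightarrow> commutator d f \<in> I"
    using ideal(1) by (auto simp: lie_ideal_def)
  have bracket': "commutator f d \<in> I" if "d \<in> L" "f \<in> I" for d f
    using F.subspace_neg[OF I(1) bracket[OF that]] by (simp add: commutator_swap[of f d])
  have ad_L: "ad (ad a b) \<in> L" for a b
    using L(2) ad_in_commutator_span[of a UNIV b] by (auto simp: inner_commutators_def)
  obtain d where d: "d \<in> I" "d \<noteq> 0" using ideal(2) F.subspace_0[OF I(1)] by blast
  then have d_Der: "d \<in> Der smul" using I(2) L(1) by blast
  obtain x where x: "d x \<noteq> 0" using d(2) by (auto simp: fun_eq_iff)
  obtain n e where e: "matrix_units smul n e" "x \<in> matrix_units.full smul n e"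
    using finite_subset_of_full[of "{x}"] by auto
  interpret E: matrix_units smul n e by (rule e(1))
  obtain i j where ij: "i < n" "j < n" "i \<noteq> j" "\<nexists>c. d (e i j) = smul c 1"
    using E.derivation_eq_0_on_full[OF d_Der two _ e(2)] x by blast
  let ?y = "d (e i j)" and ?J = "{x. ad x \<in> I}"
  have "ad (e i j) \<in> L" using ad_L[of "e i i" "e i j"] ij by (simp add: E.off_diagonal_unit)
  then have y: "?y \<in> ?J" using bracket'[OF _ d(1)] by (simp add: commutator_ad[OF d_Der, symmetric])
  have "commutator_span UNIV \<subseteq> ?J"
  proof (rule commutator_span_minimal)
    show J: "subspace ?J" by (rule subspace_ad_vimage[OF I(1)])
    fix a b
    obtain m f where f: "matrix_units smul m f" "{?y, a, b} \<subseteq> matrix_units.full smul m f"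
      using finite_subset_of_full[of "{?y, a, b}"] by auto
    interpret M: matrix_units smul m f by (rule f(1))
    have "ad u (ad v w) \<in> ?J" if "u \<in> ?J" for u v w
      using bracket'[OF ad_L[of v w], of "ad u"] that by (simp add: commutator_ad[OF ad_in_Der])
    then have "commutator_span M.full \<subseteq> ?J"
      using M.lie_ideal_contains_commutators[OF two J _ y _ ij(4)] f(2) by blast
    then show "ad a b \<in> ?J" using ad_in_commutator_span[of a M.full b] f(2) by blast
  qed
  then show ?thesis by (auto simp: inner_commutators_def)
qed

lemma topologically_simple_if_closure:
  assumes two: "(2::'f) \<noteq> 0"
    and L: "L \<subseteq> Der smul" "inner_commutators \<subseteq> L" "L \<subseteq> pointwise_closure inner_commutators"
  shows "topologically_simple smul L"
  unfolding topologically_simple_def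
proof (intro allI impI)
  fix I assume I: "lie_ideal smul L I \<and> closedin (subtopology tykhonoff L) I"
  show "I = {0} \<or> I = L"
  proof (cases "I = {0}")
    case False
    then have "inner_commutators \<subseteq> I"
      using nonzero_ideal_contains_inner_commutators[OF two _ _ L(1,2)] I by blast
    then have "L \<subseteq> L \<inter> pointwise_closure I" using L(3) pointwise_closure_mono by blast
    then show ?thesis using I by (auto simp: closedin_tykhonoff_iff)
  qed simp
qed

lemma topologically_simple_lie_derived_Der:
  assumes "(2::'f) \<noteq> 0"
  shows "topologically_simple smul (lie_derived smul (Der smul))"
proof (rule topologically_simple_if_closure[OF assms])
  show "lie_derived smul (Der smul) \<subseteq> Der smul"
    by (rule lie_subalgebra_lie_derived(2)[OF vector_space_axioms lie_subalgebra_Der])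
  show "inner_commutators \<subseteq> lie_derived smul (Der smul)"
    by (auto simp: inner_commutators_def intro: ad_in_lie_derived)
qed (rule lie_derived_Der_subset_closure)

end


section \<open>The Lie algebra of all derivations\<close>

lemma nu_steinitz_number:
  assumes "prime p"
  shows "nu (steinitz_number smul) p = (SUP n\<in>unital_matrix_degrees smul. enat (multiplicity p n))"
  using assms by (simp add: steinitz_number_def nu_steinitz_lcm steinitz_of_nat.rep_eq image_image)

context unital_locally_matrix_algebra
begin

text \<open>
  On a finite set a derivation is \<open>ad a\<close>, and \<open>a\<close> is a multiple of \<open>e 0 0\<close> modulo commutators. A
  correction by a scalar does not change \<open>ad a\<close>, so the hypothesis makes all derivations limits of
  \<open>inner_commutators\<close>.
\<close>

lemma topologically_simple_Der_if:
  assumes two: "(2::'f) \<noteq> 0"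
    and corner: "\<And>n e. matrix_units smul n e \<Longrightarrow> n \<in> unital_matrix_degrees smul \<Longrightarrow>
      \<exists>c. e 0 0 - smul c 1 \<in> commutator_span UNIV"
  shows "topologically_simple smul (Der smul)"
proof (rule topologically_simple_if_closure[OF two order_refl])
  show "inner_commutators \<subseteq> Der smul" by (auto simp: inner_commutators_def ad_in_Der)
  show "Der smul \<subseteq> pointwise_closure inner_commutators"
  proof
    fix d assume d: "d \<in> Der smul"
    show "d \<in> pointwise_closure inner_commutators"
      unfolding pointwise_closure_def
    proof (intro CollectI allI impI)
      fix S :: "'a set" assume "finite S"
      from derivation_inner_on_finite[OF d this] obtain n e a where
        e: "matrix_units smul n e" "n \<in> unital_matrix_degrees smul" and
        a: "a \<in> matrix_units.full smul n e" "\<forall>x\<in>S. d x = ad a x" by blast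
      interpret E: matrix_units smul n e by (rule e(1))
      obtain t where t: "a - smul t (e 0 0) \<in> commutator_span E.full"
        using E.full_modulo_commutators[OF a(1)] by blast
      obtain c where c: "e 0 0 - smul c 1 \<in> commutator_span UNIV"
        using corner[OF e] by blast
      note K = subspace_commutator_span[of UNIV]
      have "(a - smul t (e 0 0)) + smul t (e 0 0 - smul c 1) \<in> commutator_span UNIV"
        using t c commutator_span_mono[of E.full UNIV]
        by (intro subspace_add[OF K] subspace_scale[OF K]) auto
      then have "a - smul (t * c) 1 \<in> commutator_span UNIV"
        by (simp add: scale_right_diff_distrib)
      moreover have "ad (a - smul (t * c) 1) x = ad a x" for x
        by (simp add: ad_def algebra_simps smul_mult_left smul_mult_right)
      ultimately show "\<exists>g\<in>inner_commutators. \<forall>s\<in>S. d s = g s"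
        using a(2)
        by (intro bexI[of _ "ad (a - smul (t * c) 1)"]) (simp_all add: inner_commutators_def)
    qed
  qed
qed

lemma common_refinement:
  assumes "matrix_units smul n e" and "matrix_units smul m g"
  shows "\<exists>N f. matrix_units smul N f \<and> N \<in> unital_matrix_degrees smul \<and>
    (\<forall>i<n. \<forall>j<n. e i j \<in> matrix_units.full smul N f) \<and>
    (\<forall>i<m. \<forall>j<m. g i j \<in> matrix_units.full smul N f)"
proof -
  let ?S = "case_prod e ` ({..<n} \<times> {..<n}) \<union> case_prod g ` ({..<m} \<times> {..<m})"
  obtain N f where "matrix_units smul N f" "N \<in> unital_matrix_degrees smul"
    "?S \<subseteq> matrix_units.full smul N f"
    using finite_subset_of_full[of ?S] by auto
  then show ?thesis by (intro exI[of _ N] exI[of _ f]) auto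
qed

text \<open>
  The average of the differences \<open>e 0 0 - e i i\<close>, each of which is a commutator, is
  \<open>e 0 0 - 1/n\<close>.
\<close>

lemma corner_scalar_if_degree_invertible:
  assumes "matrix_units smul n e" and "(of_nat n :: 'f) \<noteq> 0"
  shows "e 0 0 - smul (inverse (of_nat n)) 1 \<in> commutator_span UNIV"
proof -
  interpret matrix_units smul n e by (rule assms(1))
  note K = subspace_commutator_span[of UNIV]
  have "(\<Sum>i<n. ad (e 0 i) (e i 0)) = (\<Sum>i<n. e 0 0 - e i i)"
    using size_pos by (intro sum.cong) (auto simp: ad_def unit_mult)
  also have "\<dots> = smul (of_nat n) (e 0 0) - 1"
    by (simp add: sum_subtractf sum_units smul_of_nat)
  finally have "smul (inverse (of_nat n)) (\<Sum>i<n. ad (e 0 i) (e i 0)) =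
      e 0 0 - smul (inverse (of_nat n)) 1"
    using assms(2) by (simp add: scale_right_diff_distrib)
  moreover have "smul (inverse (of_nat n)) (\<Sum>i<n. ad (e 0 i) (e i 0)) \<in> commutator_span UNIV"
    by (intro subspace_scale[OF K] subspace_sum[OF K] ad_in_commutator_span UNIV_I)
  ultimately show ?thesis by simp
qed

text \<open>
  In a matrix algebra containing both given ones, of degree \<open>M = n * r = N * s\<close>, the power of the
  characteristic in \<open>N\<close> forces the characteristic to divide the rank \<open>r\<close> of \<open>e 0 0\<close>, so \<open>e 0 0\<close> is
  congruent to 0 modulo commutators.
\<close>

lemma corner_commutator_if_degrees_unbounded:
  assumes p: "prime CHAR('f)" and e: "matrix_units smul n e"
    and N: "N \<in> unital_matrix_degrees smul" "multiplicity CHAR('f) n < multiplicity CHAR('f) N"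
  shows "e 0 0 \<in> commutator_span UNIV"
proof -
  let ?p = "CHAR('f)"
  obtain g where g: "matrix_units smul N g" using matrix_units_of_degree[OF N(1)] by blast
  obtain M f where f: "matrix_units smul M f" and
    sub: "\<And>i j. i < n \<Longrightarrow> j < n \<Longrightarrow> e i j \<in> matrix_units.full smul M f"
      "\<And>i j. i < N \<Longrightarrow> j < N \<Longrightarrow> g i j \<in> matrix_units.full smul M f"
    using common_refinement[OF e g] by blast
  interpret M: matrix_units smul M f by (rule f)
  obtain r where r: "M = n * r" "e 0 0 - smul (of_nat r) (f 0 0) \<in> commutator_span M.full"
    using M.embedded_matrix_units[OF e sub(1)] by blast
  obtain s where s: "M = N * s"
    using M.embedded_matrix_units[OF g sub(2)] by blast
  have n: "n \<noteq> 0" using matrix_units.size_pos[OF e] by simp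
  have "?p dvd r"
  proof (rule ccontr)
    assume "\<not> ?p dvd r"
    then have cop: "coprime (?p ^ Suc (multiplicity ?p n)) r"
      using p by (simp add: prime_imp_coprime)
    have "?p ^ Suc (multiplicity ?p n) dvd N"
      using N(2) by (intro multiplicity_dvd') simp
    then have "?p ^ Suc (multiplicity ?p n) dvd n * r" using r(1) s by (metis dvd_mult2)
    then have "?p ^ Suc (multiplicity ?p n) dvd n"
      using cop by (simp only: coprime_dvd_mult_left_iff)
    moreover have "\<not> is_unit ?p" using p by auto
    ultimately show False using n by (simp add: power_dvd_iff_le_multiplicity del: power_Suc)
  qed
  then have "(of_nat r :: 'f) = 0" by (simp add: of_nat_eq_0_iff_char_dvd)
  then show ?thesis using r(2) commutator_span_mono[of M.full UNIV] by auto
qed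

text \<open>
  A sum of commutators involves finitely many elements, and any matrix algebra containing them
  sees that \<open>x\<close> is a sum of commutators.
\<close>

lemma commutator_span_local:
  assumes "x \<in> commutator_span UNIV"
  shows "\<exists>S. finite S \<and> (\<forall>n e. matrix_units smul n e \<longrightarrow> S \<subseteq> matrix_units.full smul n e \<longrightarrow>
    x \<in> commutator_span (matrix_units.full smul n e))"
    (is "?P x")
proof -
  note K = subspace_commutator_span
  have "commutator_span UNIV \<subseteq> {x. ?P x}"
  proof (rule commutator_span_minimal)
    show "subspace {x. ?P x}"
      unfolding subspace_def mem_Collect_eq
    proof (intro conjI ballI allI)
      show "?P 0" by (intro exI[of _ "{}"]) (simp add: subspace_0[OF K])
    next
      fix x y assume "x \<in> {x. ?P x}" "y \<in> {x. ?P x}"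
      then have "?P x" "?P y" by simp_all
      from this(1) obtain S where S: "finite S" "\<And>n e. matrix_units smul n e \<Longrightarrow>
          S \<subseteq> matrix_units.full smul n e \<Longrightarrow> x \<in> commutator_span (matrix_units.full smul n e)"
        by (elim exE conjE) simp
      from \<open>?P y\<close> obtain T where T: "finite T" "\<And>n e. matrix_units smul n e \<Longrightarrow>
          T \<subseteq> matrix_units.full smul n e \<Longrightarrow> y \<in> commutator_span (matrix_units.full smul n e)"
        by (elim exE conjE) simp
      show "?P (x + y)"
        by (intro exI[of _ "S \<union> T"] conjI allI impI finite_UnI S(1) T(1) subspace_add[OF K] S(2) T(2))
          simp_all
    next
      fix c x assume "x \<in> {x. ?P x}"
      then have "?P x" by simp
      then obtain S where S: "finite S" "\<And>n e. matrix_units smul n e \<Longrightarrow>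
          S \<subseteq> matrix_units.full smul n e \<Longrightarrow> x \<in> commutator_span (matrix_units.full smul n e)"
        by (elim exE conjE) simp
      show "?P (smul c x)"
        by (intro exI[of _ S] conjI allI impI S(1) subspace_scale[OF K] S(2))
    qed
    show "ad a b \<in> {x. ?P x}" for a b
      unfolding mem_Collect_eq
      by (intro exI[of _ "{a, b}"]) (auto intro: ad_in_commutator_span)
  qed
  with assms show ?thesis by blast
qed

text \<open>
  The closed ideal of limits of \<open>inner_commutators\<close> is nonzero because the degree \<open>m\<close> exceeds 1. If
  it were everything, then \<open>ad (g 0 0)\<close> would agree with \<open>ad x\<close> on the units \<open>g i j\<close> for some sum \<open>x\<close>
  of commutators, so \<open>z = g 0 0 - x\<close> would commute with these units. In a large matrix algebra the
  trace of \<open>z\<close> is then a multiple of \<open>m\<close>, which is 0 in the field, but it is also the rank \<open>r\<close> of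
  \<open>g 0 0\<close>. So the characteristic would divide \<open>r\<close>, and \<open>m * r\<close> would be a degree with a higher power
  of the characteristic than \<open>m\<close>.
\<close>

lemma not_topologically_simple_Der:
  assumes p: "prime CHAR('f)" and m: "m \<in> unital_matrix_degrees smul" "CHAR('f) dvd m"
    and maximal: "\<And>N. N \<in> unital_matrix_degrees smul \<Longrightarrow>
      multiplicity CHAR('f) N \<le> multiplicity CHAR('f) m"
  shows "\<not> topologically_simple smul (Der smul)"
proof
  let ?p = "CHAR('f)" and ?I = "Der smul \<inter> pointwise_closure inner_commutators"
  assume simple: "topologically_simple smul (Der smul)"
  obtain g where g: "matrix_units smul m g" using matrix_units_of_degree[OF m(1)] by blast
  interpret G: matrix_units smul m g by (rule g)
  have m_gt: "1 < m"
    using dvd_imp_le[OF m(2) G.size_pos] prime_gt_1_nat[OF p] by simp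
  have "closedin (subtopology tykhonoff (Der smul)) ?I"
    unfolding closedin_tykhonoff_iff
    using pointwise_closure_mono[of ?I "pointwise_closure inner_commutators"]
    by (auto simp: pointwise_closure_idem)
  then have cases: "?I = {0} \<or> ?I = Der smul"
    using simple closure_inner_commutators_ideal unfolding topologically_simple_def by blast
  have "g 0 1 \<in> commutator_span UNIV"
    using ad_in_commutator_span[of "g 0 0" UNIV "g 0 1"] m_gt by (simp add: G.off_diagonal_unit)
  then have "ad (g 0 1) \<in> inner_commutators" by (simp add: inner_commutators_def)
  then have "ad (g 0 1) \<in> ?I"
    using pointwise_closure_superset ad_in_Der by blast
  moreover have "ad (g 0 1) \<noteq> 0"
  proof
    assume "ad (g 0 1) = 0"
    then have "g 0 0 * ad (g 0 1) (g 1 0) = 0" by simp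
    then show False
      using m_gt G.unit_nonzero by (simp add: ad_def G.unit_mult right_diff_distrib)
  qed
  ultimately have "?I = Der smul" using cases by blast
  then have closure: "ad (g 0 0) \<in> pointwise_closure inner_commutators"
    using ad_in_Der by blast
  let ?S = "case_prod g ` ({..<m} \<times> {..<m})"
  obtain x where x: "x \<in> commutator_span UNIV" "\<forall>s\<in>?S. ad (g 0 0) s = ad x s"
    using pointwise_closureD[OF closure, of ?S] by (auto simp: inner_commutators_def)
  define z where "z = g 0 0 - x"
  have z_comm: "g i j * z = z * g i j" if "i < m" "j < m" for i j
  proof -
    have "g i j \<in> ?S" using that by force
    then have "ad (g 0 0) (g i j) = ad x (g i j)" using x(2) by blast
    then show ?thesis by (simp add: z_def ad_def algebra_simps)
  qed
  obtain T where T: "finite T" "\<And>n e. matrix_units smul n e \<Longrightarrow>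
      T \<subseteq> matrix_units.full smul n e \<Longrightarrow> x \<in> commutator_span (matrix_units.full smul n e)"
    using commutator_span_local[OF x(1)] by blast
  obtain N f where f: "matrix_units smul N f" "N \<in> unital_matrix_degrees smul"
    "T \<union> ?S \<union> {x} \<subseteq> matrix_units.full smul N f"
    using finite_subset_of_full[of "T \<union> ?S \<union> {x}"] T(1) by auto
  interpret M: matrix_units smul N f by (rule f(1))
  have sub: "g i j \<in> M.full" if "i < m" "j < m" for i j
    using f(3) that by force
  obtain r where r: "N = m * r" "g 0 0 - smul (of_nat r) (f 0 0) \<in> commutator_span M.full"
    using M.embedded_matrix_units[OF g sub] by blast
  have "z \<in> M.full"
    using f(3) sub[OF G.size_pos G.size_pos] subspace_diff[OF M.subspace_full] by (simp add: z_def)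
  from M.corner_trace_centralizer[OF g sub this z_comm]
  have "M.corner_trace z = smul (of_nat m) (M.corner_trace (g 0 0 * z))"
    by (simp add: M.smul_of_nat)
  also have "(of_nat m :: 'f) = 0" using m(2) by (simp add: of_nat_eq_0_iff_char_dvd)
  finally have "M.corner_trace z = 0" by simp
  moreover have "M.corner_trace x = 0"
    using T(2)[OF f(1)] f(3) by (intro M.corner_trace_commutator_span) auto
  moreover have "M.corner_trace (g 0 0) = smul (of_nat r) (f 0 0)"
    using M.corner_trace_commutator_span[OF r(2)]
    by (simp add: M.corner_trace_diff M.corner_trace_smul M.corner_trace_unit)
  ultimately have "smul (of_nat r) (f 0 0) = 0" by (simp add: z_def M.corner_trace_diff)
  then have "?p dvd r" using M.unit_nonzero by (simp add: of_nat_eq_0_iff_char_dvd)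
  moreover have "r \<noteq> 0" using r(1) M.size_pos by auto
  ultimately have "0 < multiplicity ?p r"
    using p by (simp add: prime_multiplicity_gt_zero_iff)
  then have "multiplicity ?p m < multiplicity ?p N"
    using r(1) \<open>r \<noteq> 0\<close> G.size_pos p by (simp add: prime_elem_multiplicity_mult_distrib)
  then show False using maximal[OF f(2)] by simp
qed

end


theorem theorem2:
  fixes smul :: "'f::field \<Rightarrow> 'a::ring_1 \<Rightarrow> 'a"
  assumes "locally_matrix_algebra smul"
    and "CHAR('f) \<noteq> 2"
  shows "topologically_simple smul (lie_derived smul (Der smul)) \<and>
    (topologically_simple smul (Der smul) \<longleftrightarrow>
      CHAR('f) = 0 \<or>
      (\<exists>p. CHAR('f) = p \<and> p > 0 \<and>
        (nu (steinitz_number smul) p = 0 \<or> nu (steinitz_number smul) p = \<infinity>)))"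
proof -
  interpret unital_locally_matrix_algebra smul
    using assms(1) by (simp add: unital_locally_matrix_algebra_def)
  let ?p = "CHAR('f)" and ?D = "unital_matrix_degrees smul"
  have two: "(2::'f) \<noteq> 0"
  proof
    assume "(2::'f) = 0"
    then have "?p dvd 2" using of_nat_eq_0_iff_char_dvd[of 2, where 'a = 'f] by simp
    then show False using assms(2) CHAR_not_1[where 'a = 'f] prime_nat_iff[of 2]
      two_is_prime_nat by auto
  qed
  have "topologically_simple smul (Der smul) \<longleftrightarrow> ?p = 0 \<or> nu (steinitz_number smul) ?p = 0 \<or>
      nu (steinitz_number smul) ?p = \<infinity>"
  proof (cases "?p = 0")
    case True
    have "topologically_simple smul (Der smul)"
    proof (rule topologically_simple_Der_if[OF two])
      fix n e assume e: "matrix_units smul n e"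
      have "(of_nat n :: 'f) \<noteq> 0"
        using True matrix_units.size_pos[OF e] by (simp add: of_nat_eq_0_iff_char_dvd)
      from corner_scalar_if_degree_invertible[OF e this]
      show "\<exists>c. e 0 0 - smul c 1 \<in> commutator_span UNIV" ..
    qed
    then show ?thesis using True by simp
  next
    case False
    then have p: "prime ?p" by (intro prime_CHAR_semidom) simp
    have nu: "nu (steinitz_number smul) ?p = (SUP n\<in>?D. enat (multiplicity ?p n))"
      by (rule nu_steinitz_number[OF p])
    consider (zero) "nu (steinitz_number smul) ?p = 0"
      | (infinite) "nu (steinitz_number smul) ?p = \<infinity>"
      | (finite) k where "nu (steinitz_number smul) ?p = enat k" "k \<noteq> 0"
      by (cases "nu (steinitz_number smul) ?p") (auto simp: zero_enat_def)
    then show ?thesis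
    proof cases
      case zero
      have "topologically_simple smul (Der smul)"
      proof (rule topologically_simple_Der_if[OF two])
        fix n e assume e: "matrix_units smul n e" and n: "n \<in> ?D"
        have "enat (multiplicity ?p n) \<le> 0"
          unfolding zero[symmetric] nu using n by (rule SUP_upper)
        then have "\<not> ?p dvd n"
          using p matrix_units.size_pos[OF e]
            prime_multiplicity_gt_zero_iff[of ?p n] by (simp add: zero_enat_def)
        then have "(of_nat n :: 'f) \<noteq> 0" by (simp add: of_nat_eq_0_iff_char_dvd)
        from corner_scalar_if_degree_invertible[OF e this]
        show "\<exists>c. e 0 0 - smul c 1 \<in> commutator_span UNIV" ..
      qed
      then show ?thesis using zero by simp
    next
      case infinite
      have "topologically_simple smul (Der smul)"
      proof (rule topologically_simple_Der_if[OF two])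
        fix n e assume e: "matrix_units smul n e"
        have "\<exists>N\<in>?D. multiplicity ?p n < multiplicity ?p N"
        proof (rule ccontr)
          assume "\<not> ?thesis"
          then have "(SUP n\<in>?D. enat (multiplicity ?p n)) \<le> enat (multiplicity ?p n)"
            by (intro SUP_least) auto
          then show False using infinite nu by simp
        qed
        then have "e 0 0 \<in> commutator_span UNIV"
          using corner_commutator_if_degrees_unbounded[OF p e] by blast
        then show "\<exists>c. e 0 0 - smul c 1 \<in> commutator_span UNIV" by (intro exI[of _ 0]) simp
      qed
      then show ?thesis using infinite by simp
    next
      case (finite k)
      have bound: "multiplicity ?p n \<le> k" if "n \<in> ?D" for n
      proof -
        have "enat (multiplicity ?p n) \<le> enat k"
          unfolding finite(1)[symmetric] nu using that by (rule SUP_upper)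
        then show ?thesis by simp
      qed
      obtain n where "n \<in> ?D" using finite_subset_of_full[of "{}"] by blast
      \<comment> \<open>The supremum of the exponents is finite, so it is attained at some degree.\<close>
      then obtain m where m: "m \<in> ?D" "\<And>n. n \<in> ?D \<Longrightarrow> multiplicity ?p n \<le> multiplicity ?p m"
        using ex_has_greatest_nat[of "\<lambda>n. n \<in> ?D" n "multiplicity ?p" "Suc k"] bound
        by (auto simp: less_Suc_eq_le)
      have "multiplicity ?p m \<noteq> 0"
      proof
        assume "multiplicity ?p m = 0"
        then have "(SUP n\<in>?D. enat (multiplicity ?p n)) \<le> 0"
          using m(2) by (intro SUP_least) (auto simp: zero_enat_def)
        then show False using finite nu by (simp add: zero_enat_def)
      qed
      then have "?p dvd m" by (metis not_dvd_imp_multiplicity_0)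
      then show ?thesis
        using not_topologically_simple_Der[OF p m(1) _ m(2)] finite False by (auto simp: zero_enat_def)
    qed
  qed
  then show ?thesis
    using topologically_simple_lie_derived_Der[OF two] by auto
qed

end
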